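(* Let $(W,S)$ be a Coxeter system with $S$ finite and with a fixed root system $\Phi$ arising from a geometric representation. Then the set $\Sigma$ of small roots is bipodal.
   Context: Geometric representation and roots. Fix a geometric representation of $(W,S)$: a real vector space $V$ with a symmetric bilinear form $B$, and a simple system $\Delta=\{\alpha_s : s\in S\}\subseteq V$ (finite, indexed bijectively by $S$) such that: $\sum_{\alpha\in\Delta}a_\alpha\alpha=0$ with all $a_\alpha\ge 0$ implies all $a_\alpha=0$; $B(\alpha,\beta)\in\,]-\infty,-1]\cup\{-\cos(\pi/k): k\in\mathbb N, k\geq 2\}$ for distinct $\alpha,\beta\in\Delta$; $B(\alpha,\alpha)=1$ for $\alpha\in\Delta$; and $W$ is faithfully represented in the group of linear maps preserving $B$, with $s\in S$ acting by $v\mapsto v-2B(\alpha_s,v)\alpha_s$. (So $B(\alpha_s,\alpha_t)=-\cos(\pi/m_{st})$ if the order $m_{st}$ of $st$ is finite, and $B(\alpha_s,\alpha_t)\le -1$ iff $m_{st}=\infty$.) For $A\subseteq V$, $\operatorname{cone}(A)$ is the set of non-negative linear combinations of vectors of $A$. The root system is $\Phi=W(\Delta)$, with positive roots $\Phi^+=\operatorname{cone}(\Delta)\cap\Phi$ and negative roots $\Phi^-=-\Phi^+$; $\Phi=\Phi^+\sqcup\Phi^-$. For $\beta\in\Phi$, $s_\beta\in W$ is the reflection $v\mapsto v-2B(\beta,v)\beta$. The (left) inversion set of $w\in W$ is $N(w)=\Phi^+\cap w(\Phi^-)$. Small roots. For $\alpha,\beta\in\Phi^+$, $\beta$ dominates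 $\alpha$ if for all $w\in W$, $\beta\in N(w)$ implies $\alpha\in N(w)$. A positive root is small if it dominates no positive root other than itself; $\Sigma$ is the set of small roots. Reflection subgroups and bipodality. For a reflection subgroup $W'$ of $W$ (a subgroup generated by reflections $s_\beta$, $\beta\in\Phi$), put $\Phi_{W'}=\{\beta\in\Phi: s_\beta\in W'\}$, $\Phi_{W'}^+=\Phi_{W'}\cap\Phi^+$, and let $\Delta_{W'}=\{\alpha\in\Phi^+: N(s_\alpha)\cap\Phi_{W'}=\{\alpha\}\}$ be its canonical simple system. A maximal dihedral reflection subgroup is a subgroup $W'$ generated by $\{s_\beta:\beta\in P\cap\Phi\}$, where $P$ is a plane (2-dimensional linear subspace) of $V$ containing at least two positive roots; then $\Phi_{W'}=P\cap\Phi$ and $\Delta_{W'}=\{\alpha,\beta\}$ consists of two positive roots with $\Phi^+_{W'}=\operatorname{cone}(\alpha,\beta)\cap\Phi$. A subset $A\subseteq\Phi^+$ is bipodal if for every maximal dihedral reflection subgroup $W'$ of $W$: $A\cap(\Phi_{W'}^+\setminus\Delta_{W'})\neq\emptyset$ implies $\Delta_{W'}\subseteq A$. *)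

theory Defs
  imports "HOL-Analysis.Analysis" "HOL-Algebra.Multiplicative_Group"
begin

text \<open>
  Coxeter systems. The defining property \<open>W = \<langle>S | (s t)\<^bsup>m(s,t)\<^esup> = 1\<rangle>\<close>, where \<open>m(s,t)\<close> is the
  order of \<open>s t\<close> in \<open>W\<close>, is expressed with words over \<open>S\<close>. Inverse letters are not needed: the
  relators with \<open>s = t\<close> are the words \<open>s s\<close>. The library's \<open>ord\<close> is \<open>0\<close> for elements of infinite
  order, so that \<open>m(s,t) = \<infinity>\<close> imposes no relation.
\<close>

definition word_prod :: "('g, 'b) monoid_scheme \<Rightarrow> 'g list \<Rightarrow> 'g" where
  "word_prod W u = foldr (\<lambda>s x. s \<otimes>\<^bsub>W\<^esub> x) u \<one>\<^bsub>W\<^esub>"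

definition coxeter_relator :: "('g, 'b) monoid_scheme \<Rightarrow> 'g \<Rightarrow> 'g \<Rightarrow> 'g list" where
  "coxeter_relator W s t = concat (replicate (group.ord W (s \<otimes>\<^bsub>W\<^esub> t)) [s, t])"

inductive coxeter_step :: "('g, 'b) monoid_scheme \<Rightarrow> 'g set \<Rightarrow> 'g list \<Rightarrow> 'g list \<Rightarrow> bool"
  for W S where
  "\<lbrakk>s \<in> S; t \<in> S; u \<in> lists S; v \<in> lists S\<rbrakk>
    \<Longrightarrow> coxeter_step W S (u @ coxeter_relator W s t @ v) (u @ v)"

locale coxeter_system = group W
  for W :: "('g, 'b) monoid_scheme" (structure) and S :: "'g set" +
  assumes generators_closed: "S \<subseteq> carrier W"
    and generators_generate: "generate W S = carrier W"
    and generators_involutions: "s \<in> S \<Longrightarrow> s \<noteq> \<one> \<and> s \<otimes> s = \<one>"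
    and presentation:
      "\<lbrakk>u \<in> lists S; v \<in> lists S\<rbrakk>
        \<Longrightarrow> word_prod W u = word_prod W v \<longleftrightarrow> equivclp (coxeter_step W S) u v"

definition isometry_group :: "('v::real_vector \<Rightarrow> 'v \<Rightarrow> real) \<Rightarrow> ('v \<Rightarrow> 'v) monoid" where
  "isometry_group B =
    \<lparr>carrier = {f. linear f \<and> bij f \<and> (\<forall>x y. B (f x) (f y) = B x y)},
     monoid.mult = (\<circ>), one = id\<rparr>"

definition form_reflection :: "('v::real_vector \<Rightarrow> 'v \<Rightarrow> real) \<Rightarrow> 'v \<Rightarrow> 'v \<Rightarrow> 'v" where
  "form_reflection B \<beta> = (\<lambda>v. v - (2 * B \<beta> v) *\<^sub>R \<beta>)"

definition nonneg_cone :: "'v::real_vector set \<Rightarrow> 'v set" where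
  "nonneg_cone A = {\<Sum>a\<in>F. c a *\<^sub>R a |F c. finite F \<and> F \<subseteq> A \<and> (\<forall>a\<in>F. 0 \<le> c a)}"

text \<open>
  Geometric representations. The simple roots are \<open>\<alpha> s\<close> for \<open>s \<in> S\<close>, and \<open>\<rho>\<close> is the action of
  \<open>W\<close> on the ambient space. The simple roots are only assumed to be positively independent, and
  the form \<open>B\<close> is arbitrary (possibly degenerate or indefinite).
\<close>

locale geometric_representation = coxeter_system W S
  for W :: "('g, 'b) monoid_scheme" (structure) and S :: "'g set" +
  fixes B :: "'v::real_vector \<Rightarrow> 'v \<Rightarrow> real"
    and \<alpha> :: "'g \<Rightarrow> 'v"
    and \<rho> :: "'g \<Rightarrow> 'v \<Rightarrow> 'v"
  assumes finite_S: "finite S"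
    and B_bilinear: "bilinear B"
    and B_sym: "B x y = B y x"
    and simple_inj: "inj_on \<alpha> S"
    and simple_pos_indep:
      "\<lbrakk>\<forall>s\<in>S. 0 \<le> a s; (\<Sum>s\<in>S. a s *\<^sub>R \<alpha> s) = 0\<rbrakk> \<Longrightarrow> \<forall>s\<in>S. a s = 0"
    and simple_form:
      "\<lbrakk>s \<in> S; t \<in> S; s \<noteq> t\<rbrakk>
        \<Longrightarrow> B (\<alpha> s) (\<alpha> t) \<in> {..- 1} \<union> {- cos (pi / real k) |k::nat. 2 \<le> k}"
    and simple_norm: "s \<in> S \<Longrightarrow> B (\<alpha> s) (\<alpha> s) = 1"
    and rep_hom: "\<rho> \<in> hom W (isometry_group B)"
    and rep_faithful: "inj_on \<rho> (carrier W)"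
    and rep_simple: "s \<in> S \<Longrightarrow> \<rho> s = form_reflection B (\<alpha> s)"
begin

definition simple_roots :: "'v set" where
  "simple_roots = \<alpha> ` S"

definition roots :: "'v set" where
  "roots = {\<rho> w a |w a. w \<in> carrier W \<and> a \<in> simple_roots}"

definition pos_roots :: "'v set" where
  "pos_roots = nonneg_cone simple_roots \<inter> roots"

definition neg_roots :: "'v set" where
  "neg_roots = uminus ` pos_roots"

definition inversions :: "'g \<Rightarrow> 'v set" where
  "inversions w = pos_roots \<inter> \<rho> w ` neg_roots"

text \<open>
  For a root \<open>\<beta> = \<rho> w (\<alpha> s)\<close> the element below is \<open>w s w\<inverse>\<close>; it is unique because \<open>\<rho>\<close> is faithful.
\<close>

definition root_reflection :: "'v \<Rightarrow> 'g" where
  "root_reflection \<beta> = (THE r. r \<in> carrier W \<and> \<rho> r = form_reflection B \<beta>)"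

definition dominates :: "'v \<Rightarrow> 'v \<Rightarrow> bool" where
  "dominates \<beta> \<gamma> \<longleftrightarrow> (\<forall>w\<in>carrier W. \<beta> \<in> inversions w \<longrightarrow> \<gamma> \<in> inversions w)"

definition small_roots :: "'v set" where
  "small_roots = {\<beta> \<in> pos_roots. \<forall>\<gamma>\<in>pos_roots. dominates \<beta> \<gamma> \<longrightarrow> \<gamma> = \<beta>}"

definition sub_roots :: "'g set \<Rightarrow> 'v set" where
  "sub_roots H = {\<beta> \<in> roots. root_reflection \<beta> \<in> H}"

definition sub_pos_roots :: "'g set \<Rightarrow> 'v set" where
  "sub_pos_roots H = sub_roots H \<inter> pos_roots"

definition canonical_simple :: "'g set \<Rightarrow> 'v set" where
  "canonical_simple H =
    {\<beta> \<in> pos_roots. inversions (root_reflection \<beta>) \<inter> sub_roots H = {\<beta>}}"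

definition maximal_dihedral :: "'g set \<Rightarrow> bool" where
  "maximal_dihedral H \<longleftrightarrow>
    (\<exists>P. subspace P \<and> dim P = 2 \<and>
      (\<exists>\<beta> \<gamma>. \<beta> \<in> P \<inter> pos_roots \<and> \<gamma> \<in> P \<inter> pos_roots \<and> \<beta> \<noteq> \<gamma>) \<and>
      H = generate W (root_reflection ` (P \<inter> roots)))"

definition bipodal :: "'v set \<Rightarrow> bool" where
  "bipodal A \<longleftrightarrow> A \<subseteq> pos_roots \<and>
    (\<forall>H. maximal_dihedral H \<longrightarrow>
      A \<inter> (sub_pos_roots H - canonical_simple H) \<noteq> {} \<longrightarrow> canonical_simple H \<subseteq> A)"

end

end

theory Submission
  imports Defs
begin

text \<open>
  Write \<open>v > 0\<close> when \<open>v\<close> lies in the cone of the simple roots and \<open>v < 0\<close> when \<open>- v\<close> does. Let \<open>P\<close> be the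
  plane of a maximal dihedral reflection subgroup, \<open>\<gamma>\<close> a positive root in \<open>P\<close> outside the canonical
  simple system, and \<open>\<alpha>\<close> a canonical simple root of \<open>P\<close>. It has to be shown that \<open>\<gamma>\<close> is not small if
  \<open>\<alpha>\<close> is not small.

  Two consequences of dominance translate the problem into geometry. If \<open>x\<close> dominates \<open>y\<close> then
  \<open>B(x, y) \<ge> 1\<close> and \<open>g x - g y\<close> stays in the cone for every \<open>g\<close> in the group (\<open>dom_form_ge_1\<close>,
  \<open>dom_diff\<close>); conversely, \<open>B(x, y) \<ge> 1\<close> forces one of the two roots to dominate the other
  (\<open>dom_total\<close>). Both are statements about the sequence of roots that the dihedral group of \<open>x\<close> and
  \<open>y\<close> produces; they rest on the decomposition of the roots into positive and negative ones
  (\<open>root_sign\<close>) and on the finiteness of inversion sets (\<open>finite_inversions\<close>).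

  Suppose that \<open>\<gamma>\<close> is small. Since \<open>\<gamma>\<close> is not canonical, it lies strictly between two positive roots of
  \<open>P\<close> that are exchanged by \<open>- s\<^sub>\<gamma>\<close>, and their form with \<open>\<gamma>\<close> is below \<open>1\<close>, as \<open>\<gamma>\<close> would dominate one of
  them otherwise. So \<open>P\<close> is a Euclidean plane, and the roots in it are the unit vectors at the angles
  \<open>k \<pi> / m\<close>, where the positive ones are those with \<open>0 \<le> k < m\<close>, \<open>\<alpha>\<close> is the one with \<open>k = 0\<close>, and
  \<open>1 \<le> k \<le> m - 2\<close> for \<open>\<gamma>\<close> (\<open>plane_polygon\<close>). Not being small is inherited by \<open>s\<^sub>\<rho> x\<close> from \<open>x\<close> whenever
  \<open>\<rho> > 0\<close> and \<open>B(x, \<rho>) \<le> 0\<close> (\<open>nonsmall_refl\<close>). Such reflections lead from position \<open>0\<close> to all interior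
  positions \<open>k\<close> with the parity of \<open>m\<close>, and from position \<open>1\<close> to the others. If \<open>m\<close> is odd, position
  \<open>1\<close> is reached from \<open>0\<close>. If \<open>m\<close> is even, \<open>\<alpha>\<close> and the root at position \<open>1\<close> lie in different orbits of the
  dihedral group, and a separate argument is needed.

  That argument is \<open>neighbour_nonsmall\<close>, the heart of the proof. Let \<open>\<beta>\<close> be the other canonical root,
  so that position \<open>1\<close> is \<open>\<gamma>\<^sub>1 = s\<^sub>\<alpha> \<beta> = \<beta> + 2 c \<alpha>\<close> with \<open>c = - B(\<alpha>, \<beta>) = cos (\<pi> / m) \<ge> 1 / \<surd>2\<close>, and let \<open>\<alpha>\<close>
  dominate \<open>\<delta>\<close>. Among the finitely many roots of the form \<open>s \<delta> + p \<alpha> + q \<beta>\<close> with \<open>s > 0\<close> and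
  \<open>p, q \<ge> 0\<close>, choose \<open>\<eta>\<close> such that no other root is obtained from it in this way. (In the Tits cone,
  passing from \<open>\<delta>\<close> to \<open>\<eta>\<close> moves the mirror towards the axis of the dihedral group, inside the sector
  between the mirrors of \<open>\<alpha>\<close> and \<open>\<beta>\<close> that contains the fundamental chamber.) By extremality,
  \<open>k\<^sub>1 = B(\<eta>, \<alpha>)\<close> is \<open>0\<close>, \<open>1 / 2\<close> or at least \<open>1 / \<surd>2\<close>, and \<open>k\<^sub>2 = B(\<eta>, \<beta>)\<close> is \<open>0\<close> or at least \<open>1 / 2\<close>.
  Therefore \<open>\<gamma>\<^sub>1\<close> dominates \<open>\<eta>\<close>, because \<open>B(\<gamma>\<^sub>1, \<eta>) = 2 c k\<^sub>1 + k\<^sub>2 \<ge> 1\<close>, unless \<open>k\<^sub>1 = 0\<close>, or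
  \<open>k\<^sub>1 = 1 / 2\<close> and \<open>k\<^sub>2 = 0\<close>. In these two cases the inequality \<open>B(\<alpha>, \<delta>) \<ge> 1\<close> becomes a quadratic
  inequality for \<open>q\<close>, and it implies that a specific further root in the span of \<open>\<alpha>, \<beta>, \<eta>\<close> is
  positive and has form at least \<open>1\<close> with \<open>\<gamma>\<^sub>1\<close>.
\<close>

section \<open>Preliminaries on real numbers and planes\<close>

text \<open>
  The Chebyshev polynomials of the second kind with shifted index: the coefficients of the roots of a
  dihedral group whose two generating roots have form \<open>- c\<close>.
\<close>
fun sine_ratio :: "real \<Rightarrow> nat \<Rightarrow> real" where
  "sine_ratio c 0 = 0"
| "sine_ratio c (Suc 0) = 1"
| "sine_ratio c (Suc (Suc n)) = 2 * c * sine_ratio c (Suc n) - sine_ratio c n"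

lemma sine_ratio_cos: "sin t * sine_ratio (cos t) n = sin (real n * t)"
proof (induction "cos t" n rule: sine_ratio.induct)
  case (3 n)
  define y where "y = real (Suc n) * t"
  have "sin (y + t) + sin (y - t) = 2 * cos t * sin y" by (simp add: sin_add sin_diff)
  moreover have "real (Suc (Suc n)) * t = y + t" "real n * t = y - t" by (simp_all add: y_def algebra_simps)
  ultimately show ?case using 3 by (simp add: y_def algebra_simps)
qed auto

lemma sine_ratio_increases:
  assumes "1 \<le> c" shows "0 \<le> sine_ratio c n \<and> sine_ratio c n + 1 \<le> sine_ratio c (Suc n)"
proof (induction n)
  case (Suc n)
  then have "sine_ratio c (Suc n) \<le> c * sine_ratio c (Suc n)" using assms by (simp add: mult_le_cancel_right1)
  with Suc show ?case by (simp only: sine_ratio.simps mult.assoc) linarith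
qed simp

lemma sine_ratio_strict_mono: "1 \<le> c \<Longrightarrow> strict_mono (sine_ratio c)"
  unfolding strict_mono_Suc_iff using sine_ratio_increases[of c] by (meson less_add_one less_le_trans)

lemma scaleR_twice: "(x * 2) *\<^sub>R v = x *\<^sub>R v + x *\<^sub>R (v::'a::real_vector)"
  by (simp only: mult_2_right scaleR_left_distrib)

lemma pi_div_bounds:
  assumes "2 \<le> (k::nat)" shows "0 < pi / real k" "pi / real k \<le> pi / 2" "pi / real k < pi"
proof -
  show "pi / real k \<le> pi / 2" using assms by (intro divide_left_mono) auto
  then show "pi / real k < pi" using pi_gt_zero by linarith
qed (use assms in simp)

text \<open>
  The quadratic polynomial in \<open>q\<close> has discriminant \<open>4 c\<^sup>2 - 3\<close>, which gives the bound on \<open>c\<close>. At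
  \<open>q\<^sub>0 = (4 c\<^sup>2 - 1) / m\<close> with \<open>m = 8 c\<^sup>3 - 4 c\<close> its value is \<open>(1 - c\<^sup>2) / m\<^sup>2 > 0\<close>, and it decreases up to
  \<open>q\<^sub>0\<close>; so it is positive to the left of \<open>q\<^sub>0\<close>.
\<close>
lemma half_angle_quadratic:
  fixes c q :: real
  assumes "0 < c" "c < 1" "0 \<le> q" and quad: "3 / 4 - q * c + q\<^sup>2 * (1 - c\<^sup>2) \<le> 0"
  shows "3 / 4 \<le> c\<^sup>2" "4 * c\<^sup>2 - 1 \<le> q * (8 * c ^ 3 - 4 * c)"
proof -
  define S where "S = c\<^sup>2"
  have S1: "S < 1" using assms(1,2) by (simp add: S_def power_strict_decreasing_iff abs_square_less_1)
  have "0 \<le> (2 * q * (1 - S) - c)\<^sup>2" by simp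
  also have "\<dots> = 4 * (1 - S) * (3 / 4 - q * c + q\<^sup>2 * (1 - S)) + (4 * S - 3)"
    by (simp add: S_def power2_eq_square algebra_simps)
  also have "\<dots> \<le> 0 + (4 * S - 3)"
    using quad S1 by (intro add_right_mono mult_nonneg_nonpos) (auto simp: S_def)
  finally have S: "3 / 4 \<le> S" by simp
  then show "3 / 4 \<le> c\<^sup>2" by (simp add: S_def)
  show "4 * c\<^sup>2 - 1 \<le> q * (8 * c ^ 3 - 4 * c)"
  proof (rule ccontr)
    assume "\<not> ?thesis"
    then have e: "0 < 4 * S - 1 - q * (8 * c ^ 3 - 4 * c)" (is "0 < ?e") by (simp add: S_def)
    have m: "8 * c ^ 3 - 4 * c = 4 * c * (2 * S - 1)" by (simp add: S_def power3_eq_cube power2_eq_square algebra_simps)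
    \<comment> \<open>The expansion at \<open>q\<^sub>0\<close>, multiplied by \<open>m\<^sup>2\<close>, in the variable \<open>4 c\<^sup>2 - 1 - q m\<close>.\<close>
    have "(8 * c ^ 3 - 4 * c)\<^sup>2 * (3 / 4 - q * c + q\<^sup>2 * (1 - S))
        = (1 - S) + ?e * (2 * (8 * S\<^sup>2 - 7 * S + 1)) + ?e\<^sup>2 * (1 - S)"
      unfolding S_def by (simp add: power2_eq_square power3_eq_cube algebra_simps)
    moreover have "(8 * c ^ 3 - 4 * c)\<^sup>2 * (3 / 4 - q * c + q\<^sup>2 * (1 - S)) \<le> 0"
      using quad by (intro mult_nonneg_nonpos) (auto simp: S_def)
    moreover have "0 \<le> 8 * S\<^sup>2 - 7 * S + 1"
    proof -
      have "8 * S\<^sup>2 - 7 * S + 1 = (S - 3 / 4) * (8 * S - 1) + 1 / 4" by (simp add: power2_eq_square algebra_simps)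
      moreover have "0 \<le> (S - 3 / 4) * (8 * S - 1)" using S by (intro mult_nonneg_nonneg) auto
      ultimately show ?thesis by simp
    qed
    then have "0 \<le> ?e * (2 * (8 * S\<^sup>2 - 7 * S + 1))" using e by (intro mult_nonneg_nonneg) auto
    moreover have "0 \<le> ?e\<^sup>2 * (1 - S)" using S1 by simp
    ultimately show False using S1 by linarith
  qed
qed

lemma plane_spanned:
  assumes P: "subspace P" "dim P = 2" and xy: "x \<in> P" "y \<in> P" "x \<noteq> 0" "\<And>t. y \<noteq> t *\<^sub>R x"
    and v: "v \<in> P"
  shows "\<exists>s t. v = s *\<^sub>R x + t *\<^sub>R (y::'a::real_vector)"
proof -
  obtain A where A: "A \<subseteq> P" "independent A" "P \<subseteq> span A" "card A = 2"
    using basis_exists[of P] P(2) by metis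
  have "finite A" using A(4) card.infinite by fastforce
  have ind: "independent {y, x}"
  proof (rule independent_insertI)
    show "y \<notin> span {x}" using xy(4) by (auto simp: span_singleton)
    show "independent {x}" using xy(3) by simp
  qed
  have "v \<in> span {y, x}"
  proof (rule ccontr)
    assume nin: "v \<notin> span {y, x}"
    then have i: "independent {v, y, x}" using ind by (rule independent_insertI)
    have "{v, y, x} \<subseteq> P" using v xy(1,2) by blast
    then have "{v, y, x} \<subseteq> span A" using A(3) by (rule subset_trans)
    from independent_span_bound[OF \<open>finite A\<close> i this] have "card {v, y, x} \<le> 2"
      unfolding A(4) by simp
    moreover have "v \<notin> {y, x}" using nin span_base[of v "{y, x}"] by fast
    moreover have "y \<noteq> x" using xy(4)[of 1] by simp
    ultimately show False by simp
  qed
  then obtain t where "v - t *\<^sub>R y \<in> span {x}" by (auto simp: span_breakdown_eq)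
  then obtain s where "v - t *\<^sub>R y = s *\<^sub>R x" by (auto simp: span_singleton)
  then have "v = s *\<^sub>R x + t *\<^sub>R y" by (simp add: algebra_simps)
  then show ?thesis by blast
qed

text \<open>
  The set is invariant under translation by twice any of its elements. Two elements at a small distance
  would therefore put many elements into the interval \<open>[lo, hi]\<close>; so the set is discrete, and it consists of
  the multiples of its least positive element.
\<close>
lemma reflection_closed_discrete:
  fixes \<Theta> :: "real set"
  assumes zero: "0 \<in> \<Theta>" and pi: "pi \<in> \<Theta>"
    and closed: "\<And>s t. \<lbrakk>s \<in> \<Theta>; t \<in> \<Theta>\<rbrakk> \<Longrightarrow> 2 * s - t \<in> \<Theta>"
    and gap: "lo < hi" "finite (\<Theta> \<inter> {lo..hi})"
  shows "\<exists>m::int. 0 < m \<and> \<Theta> = {of_int k * (pi / of_int m) |k::int. True}"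
proof -
  have neg: "- t \<in> \<Theta>" if "t \<in> \<Theta>" for t using closed[OF zero that] by simp
  have shift: "t + 2 * s \<in> \<Theta>" if "s \<in> \<Theta>" "t \<in> \<Theta>" for s t
    using closed[OF that(1) neg[OF that(2)]] by (simp add: algebra_simps)
  have nat_mult: "real n * t \<in> \<Theta>" if "t \<in> \<Theta>" for n t
  proof (induction n rule: induct_nat_012)
    case (ge2 n)
    then show ?case using closed[OF ge2(2,1)] by (simp add: algebra_simps)
  qed (use zero that in auto)
  have mult: "of_int k * t \<in> \<Theta>" if "t \<in> \<Theta>" for k :: int and t
  proof (cases "0 \<le> k")
    case True
    then show ?thesis using nat_mult[OF that, of "nat k"] by simp
  next
    case False
    then show ?thesis using neg[OF nat_mult[OF that, of "nat (- k)"]] by simp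
  qed
  define N where "N = card (\<Theta> \<inter> {lo..hi})"
  define \<epsilon> where "\<epsilon> = (hi - lo) / (real N + 2)"
  have \<epsilon>: "0 < \<epsilon>" using gap by (simp add: \<epsilon>_def)
  have sep: "\<epsilon> \<le> t" if t: "t \<in> \<Theta>" "0 < t" for t
  proof (rule ccontr)
    assume "\<not> \<epsilon> \<le> t"
    then have lt: "(real N + 2) * t < hi - lo" by (simp add: \<epsilon>_def field_simps)
    define k where "k = \<lceil>lo / t\<rceil>"
    have k: "lo \<le> of_int k * t" "of_int k * t < lo + t"
    proof -
      have "lo / t \<le> of_int k" "of_int k < lo / t + 1" unfolding k_def by linarith+
      then show "lo \<le> of_int k * t" "of_int k * t < lo + t" using t by (simp_all add: field_simps)
    qed
    let ?f = "\<lambda>j::nat. of_int (k + int j) * t"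
    have "?f ` {..N} \<subseteq> \<Theta> \<inter> {lo..hi}"
    proof
      fix x assume "x \<in> ?f ` {..N}"
      then obtain j where j: "j \<le> N" "x = ?f j" by auto
      have x: "x = of_int k * t + real j * t" using j by (simp add: algebra_simps)
      have jt: "0 \<le> real j * t" "real j * t \<le> real N * t" using j t by auto
      have "(real N + 2) * t = real N * t + 2 * t" by (simp add: algebra_simps)
      then have "lo \<le> x" "x \<le> hi" unfolding x using k lt t jt by linarith+
      moreover have "x \<in> \<Theta>" unfolding j(2) by (rule mult[OF t(1)])
      ultimately show "x \<in> \<Theta> \<inter> {lo..hi}" by simp
    qed
    then have "card (?f ` {..N}) \<le> N" unfolding N_def using gap(2) by (rule card_mono[rotated])
    moreover have "inj_on ?f {..N}" using t by (auto simp: inj_on_def)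
    then have "card (?f ` {..N}) = Suc N" by (simp add: card_image)
    ultimately show False by simp
  qed
  let ?P = "\<Theta> \<inter> {0<..}"
  define \<theta> where "\<theta> = Inf ?P"
  have P: "?P \<noteq> {}" "bdd_below ?P" using pi by auto
  have \<theta>_le: "\<theta> \<le> t" if "t \<in> \<Theta>" "0 < t" for t
    unfolding \<theta>_def using that P(2) by (intro cInf_lower) auto
  have \<theta>: "\<theta> \<in> \<Theta>"
  proof (rule ccontr)
    assume nin: "\<theta> \<notin> \<Theta>"
    obtain t where t: "t \<in> \<Theta>" "0 < t" "t < \<theta> + \<epsilon> / 4"
      using cInf_lessD[OF P(1), of "\<theta> + \<epsilon> / 4"] \<epsilon> unfolding \<theta>_def by auto
    then have "\<theta> < t" using \<theta>_le[OF t(1,2)] nin by (cases "\<theta> = t") auto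
    then obtain s where s: "s \<in> \<Theta>" "0 < s" "s < t"
      using cInf_lessD[OF P(1), of t] unfolding \<theta>_def by auto
    have "2 * t + 2 * (- s) \<in> \<Theta>" using shift[OF neg[OF s(1)] shift[OF t(1) zero]] by simp
    then have "\<epsilon> \<le> 2 * t + 2 * (- s)" using sep s(3) by simp
    then show False using \<theta>_le[OF s(1,2)] t(3) \<epsilon> by linarith
  qed
  have \<theta>_pos: "0 < \<theta>"
  proof -
    have "\<epsilon> \<le> \<theta>" unfolding \<theta>_def using P(1) sep by (intro cInf_greatest) auto
    then show ?thesis using \<epsilon> by simp
  qed
  have multiple: "\<exists>k::int. t = of_int k * \<theta>" if t: "t \<in> \<Theta>" for t
  proof -
    define k where "k = \<lfloor>t / (2 * \<theta>)\<rfloor>"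
    define t' where "t' = t + 2 * (of_int (- k) * \<theta>)"
    have t': "t' \<in> \<Theta>" unfolding t'_def by (rule shift[OF mult[OF \<theta>] t])
    have "of_int k \<le> t / (2 * \<theta>)" "t / (2 * \<theta>) < of_int k + 1" unfolding k_def by linarith+
    then have t'_range: "0 \<le> t'" "t' < 2 * \<theta>" using \<theta>_pos unfolding t'_def by (simp_all add: field_simps)
    have "t' = 0 \<or> t' = \<theta>"
    proof (rule ccontr)
      assume "\<not> ?thesis"
      then have "\<theta> < t'" using \<theta>_le[OF t'] t'_range by fastforce
      then show False using \<theta>_le[OF closed[OF \<theta> t']] t'_range by simp
    qed
    then have "t = of_int (2 * k) * \<theta> \<or> t = of_int (2 * k + 1) * \<theta>" by (auto simp: t'_def algebra_simps)
    then show ?thesis by blast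
  qed
  obtain m :: int where m: "pi = of_int m * \<theta>" using multiple[OF pi] by blast
  have m0: "0 < m" using m \<theta>_pos pi_gt_zero by (metis of_int_0_less_iff zero_less_mult_pos2)
  have "pi / of_int m = \<theta>" using m0 by (subst m) simp
  have "\<Theta> = {of_int k * \<theta> |k::int. True}"
  proof (rule equalityI; rule subsetI)
    fix t assume "t \<in> \<Theta>"
    then show "t \<in> {of_int k * \<theta> |k::int. True}" using multiple by simp
  next
    fix t assume "t \<in> {of_int k * \<theta> |k::int. True}"
    then obtain k :: int where "t = of_int k * \<theta>" by blast
    then show "t \<in> \<Theta>" using mult[OF \<theta>] by simp
  qed
  then have "\<Theta> = {of_int k * (pi / of_int m) |k::int. True}" unfolding \<open>pi / of_int m = \<theta>\<close> .
  then show ?thesis using m0 by blast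
qed

section \<open>Root bases\<close>

text \<open>
  The data on the real vector space that a geometric representation provides. The reflection group is
  the group of linear maps generated by the simple reflections.
\<close>
locale root_basis =
  fixes B :: "'v::real_vector \<Rightarrow> 'v \<Rightarrow> real" and \<Delta> :: "'v set"
  assumes form_bilinear: "bilinear B"
    and form_sym: "B x y = B y x"
    and finite_basis: "finite \<Delta>"
    and basis_pos_indep:
      "\<lbrakk>\<forall>a\<in>\<Delta>. 0 \<le> c a; (\<Sum>a\<in>\<Delta>. c a *\<^sub>R a) = 0\<rbrakk> \<Longrightarrow> \<forall>a\<in>\<Delta>. c a = 0"
    and basis_form:
      "\<lbrakk>a \<in> \<Delta>; b \<in> \<Delta>; a \<noteq> b\<rbrakk> \<Longrightarrow> B a b \<in> {..- 1} \<union> {- cos (pi / real k) |k::nat. 2 \<le> k}"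
    and basis_norm: "a \<in> \<Delta> \<Longrightarrow> B a a = 1"
begin

abbreviation refl :: "'v \<Rightarrow> 'v \<Rightarrow> 'v" where "refl \<equiv> form_reflection B"

lemma refl_apply: "refl a v = v - (2 * B a v) *\<^sub>R a"
  by (simp add: form_reflection_def)

lemmas form_expand =
  bilinear_ladd[OF form_bilinear] bilinear_radd[OF form_bilinear]
  bilinear_lsub[OF form_bilinear] bilinear_rsub[OF form_bilinear]
  bilinear_lmul[OF form_bilinear] bilinear_rmul[OF form_bilinear]
  bilinear_lneg[OF form_bilinear] bilinear_rneg[OF form_bilinear]
  bilinear_lzero[OF form_bilinear] bilinear_rzero[OF form_bilinear]

lemma linear_refl: "linear (refl a)"
  by (rule linearI) (simp_all add: refl_apply form_expand algebra_simps)

lemma refl_isometry: "B a a = 1 \<Longrightarrow> B (refl a x) (refl a y) = B x y"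
  using form_sym[of x a] form_sym[of y a] by (simp add: refl_apply form_expand algebra_simps)

lemma refl_self: "B a a = 1 \<Longrightarrow> refl a a = - a"
  by (simp add: refl_apply scaleR_2)

lemma refl_refl: "B a a = 1 \<Longrightarrow> refl a (refl a v) = v"
  by (simp add: refl_apply form_expand algebra_simps)

section \<open>The group generated by the simple reflections and its roots\<close>

definition act :: "'v list \<Rightarrow> 'v \<Rightarrow> 'v" where "act u = foldr (\<lambda>a g. refl a \<circ> g) u id"

lemma act_simps [simp]: "act [] = id" "act (a # u) = refl a \<circ> act u"
  by (simp_all add: act_def)

lemma act_append: "act (u @ v) = act u \<circ> act v"
  by (induction u) (simp_all add: o_assoc)

definition G :: "('v \<Rightarrow> 'v) set" where "G = act ` lists \<Delta>"

lemma id_G: "id \<in> G" and refl_basis_G: "a \<in> \<Delta> \<Longrightarrow> refl a \<in> G"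
proof -
  have "act [] \<in> G" "a \<in> \<Delta> \<Longrightarrow> act [a] \<in> G" unfolding G_def by (intro imageI; simp)+
  then show "id \<in> G" "a \<in> \<Delta> \<Longrightarrow> refl a \<in> G" by simp_all
qed

lemma comp_G: "\<lbrakk>g \<in> G; h \<in> G\<rbrakk> \<Longrightarrow> g \<circ> h \<in> G"
proof -
  assume "g \<in> G" "h \<in> G"
  then obtain u v where "g = act u" "h = act v" "u @ v \<in> lists \<Delta>" by (auto simp: G_def)
  then show ?thesis unfolding G_def by (metis act_append imageI)
qed

lemma linear_G: assumes "g \<in> G" shows "linear g"
proof -
  have "linear (act u)" for u
  proof (induction u)
    case Nil then show ?case by (simp add: linear_iff)
  next
    case (Cons a u) then show ?case
      unfolding act_simps by (rule linear_compose[OF _ linear_refl])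
  qed
  then show ?thesis using assms by (auto simp: G_def)
qed

lemma isometry_G: "g \<in> G \<Longrightarrow> B (g x) (g y) = B x y"
proof -
  have "B (act u x) (act u y) = B x y" if "u \<in> lists \<Delta>" for u
    using that by (induction u) (simp_all add: refl_isometry basis_norm)
  then show "g \<in> G \<Longrightarrow> B (g x) (g y) = B x y" by (auto simp: G_def)
qed

lemma inverse_G:
  assumes "g \<in> G" shows "\<exists>h\<in>G. (\<forall>v. h (g v) = v) \<and> (\<forall>v. g (h v) = v)"
proof -
  obtain u where u: "u \<in> lists \<Delta>" "g = act u" using assms by (auto simp: G_def)
  have 1: "act (rev u) (act u v) = v" if "u \<in> lists \<Delta>" for u v
    using that by (induction u arbitrary: v) (simp_all add: act_append refl_refl basis_norm)
  have r: "rev u \<in> lists \<Delta>" using u by auto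
  then have "act (rev u) \<in> G" by (auto simp: G_def)
  then show ?thesis using 1[OF u(1)] 1[OF r] u(2) by auto
qed

definition roots :: "'v set" where "roots = {g a |g a. g \<in> G \<and> a \<in> \<Delta>}"

lemma basis_roots: "a \<in> \<Delta> \<Longrightarrow> a \<in> roots"
proof -
  assume "a \<in> \<Delta>"
  then have "id a \<in> roots" unfolding roots_def using id_G by blast
  then show ?thesis by simp
qed

lemma G_roots: "\<lbrakk>g \<in> G; x \<in> roots\<rbrakk> \<Longrightarrow> g x \<in> roots"
proof -
  assume "g \<in> G" "x \<in> roots"
  then obtain h a where "x = h a" "h \<in> G" "a \<in> \<Delta>" by (auto simp: roots_def)
  then show ?thesis using comp_G[OF \<open>g \<in> G\<close> \<open>h \<in> G\<close>] unfolding roots_def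
    by (intro CollectI exI[of _ "g \<circ> h"] exI[of _ a]) simp
qed

lemma root_norm: "x \<in> roots \<Longrightarrow> B x x = 1"
  unfolding roots_def using isometry_G basis_norm by auto

lemma root_nonzero: "x \<in> roots \<Longrightarrow> x \<noteq> 0"
  using root_norm[of x] by (auto simp: form_expand)

lemma refl_image: 
  assumes "g \<in> G" "h \<in> G" "\<And>v. g (h v) = v"
  shows "refl (g a) = g \<circ> refl a \<circ> h"
proof
  fix v
  have "B (g a) v = B a (h v)" using isometry_G[OF assms(1), of a "h v"] assms(3) by simp
  then show "refl (g a) v = (g \<circ> refl a \<circ> h) v"
    using assms(3)
    by (simp add: refl_apply linear_diff[OF linear_G[OF assms(1)]] linear_cmul[OF linear_G[OF assms(1)]])
qed

lemma refl_root_G: "x \<in> roots \<Longrightarrow> refl x \<in> G"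
proof -
  assume "x \<in> roots"
  then obtain g a where ga: "x = g a" "g \<in> G" "a \<in> \<Delta>" by (auto simp: roots_def)
  obtain h where h: "h \<in> G" "\<forall>v. h (g v) = v" "\<forall>v. g (h v) = v" using inverse_G[OF ga(2)] by auto
  show ?thesis unfolding ga(1) refl_image[OF ga(2) h(1) spec[OF h(3)]]
    by (intro comp_G refl_basis_G ga h)
qed

lemma refl_root: "\<lbrakk>x \<in> roots; y \<in> roots\<rbrakk> \<Longrightarrow> refl x y \<in> roots"
  by (rule G_roots[OF refl_root_G])

lemma neg_root: "x \<in> roots \<Longrightarrow> - x \<in> roots"
  using refl_root[of x x] refl_self root_norm by simp

section \<open>The cone of the simple roots\<close>

abbreviation C :: "'v set" where "C \<equiv> nonneg_cone \<Delta>"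

lemma C_eq: "C = {\<Sum>a\<in>\<Delta>. c a *\<^sub>R a |c. \<forall>a\<in>\<Delta>. 0 \<le> c a}"
proof (rule equalityI; rule subsetI)
  fix v assume "v \<in> C"
  then obtain F c where F: "finite F" "F \<subseteq> \<Delta>" "\<forall>a\<in>F. 0 \<le> c a" "v = (\<Sum>a\<in>F. c a *\<^sub>R a)"
    by (auto simp: nonneg_cone_def)
  have "v = (\<Sum>a\<in>\<Delta>. (if a \<in> F then c a else 0) *\<^sub>R a)"
    unfolding F(4) by (rule sum.mono_neutral_cong_left) (use F finite_basis in auto)
  with F(3) show "v \<in> {\<Sum>a\<in>\<Delta>. c a *\<^sub>R a |c. \<forall>a\<in>\<Delta>. 0 \<le> c a}"
    by (intro CollectI exI[of _ "\<lambda>a. if a \<in> F then c a else 0"]) auto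
next
  fix v assume "v \<in> {\<Sum>a\<in>\<Delta>. c a *\<^sub>R a |c. \<forall>a\<in>\<Delta>. 0 \<le> c a}"
  then obtain c where "\<forall>a\<in>\<Delta>. 0 \<le> c a" "v = (\<Sum>a\<in>\<Delta>. c a *\<^sub>R a)" by auto
  then show "v \<in> C" using finite_basis unfolding nonneg_cone_def
    by (intro CollectI exI[of _ \<Delta>] exI[of _ c]) simp
qed

lemma C_zero: "0 \<in> C"
  unfolding C_eq by (intro CollectI exI[of _ "\<lambda>_. 0"]) simp

lemma C_E:
  assumes "x \<in> C" obtains c where "\<forall>a\<in>\<Delta>. 0 \<le> c a" "x = (\<Sum>a\<in>\<Delta>. c a *\<^sub>R a)"
  using assms unfolding C_eq mem_Collect_eq by (elim exE conjE) (rule that)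

lemma C_I: "(\<forall>a\<in>\<Delta>. 0 \<le> c a) \<Longrightarrow> (\<Sum>a\<in>\<Delta>. c a *\<^sub>R a) \<in> C"
  unfolding C_eq by (intro CollectI exI[of _ c] conjI refl)

lemma C_add: assumes "x \<in> C" "y \<in> C" shows "x + y \<in> C"
proof -
  obtain c where c: "\<forall>a\<in>\<Delta>. 0 \<le> c a" "x = (\<Sum>a\<in>\<Delta>. c a *\<^sub>R a)" by (rule C_E[OF assms(1)])
  obtain d where d: "\<forall>a\<in>\<Delta>. 0 \<le> d a" "y = (\<Sum>a\<in>\<Delta>. d a *\<^sub>R a)" by (rule C_E[OF assms(2)])
  have "x + y = (\<Sum>a\<in>\<Delta>. (c a + d a) *\<^sub>R a)"
    unfolding c(2) d(2) by (simp add: scaleR_left_distrib sum.distrib)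
  also have "\<dots> \<in> C" using c(1) d(1) by (intro C_I) simp
  finally show ?thesis .
qed

lemma C_scale: assumes "x \<in> C" "0 \<le> t" shows "t *\<^sub>R x \<in> C"
proof -
  obtain c where c: "\<forall>a\<in>\<Delta>. 0 \<le> c a" "x = (\<Sum>a\<in>\<Delta>. c a *\<^sub>R a)" by (rule C_E[OF assms(1)])
  have "t *\<^sub>R x = (\<Sum>a\<in>\<Delta>. (t * c a) *\<^sub>R a)" unfolding c(2) by (simp add: scaleR_sum_right)
  also have "\<dots> \<in> C" using c(1) assms(2) by (intro C_I) simp
  finally show ?thesis .
qed

lemma C_combine: "\<lbrakk>x \<in> C; y \<in> C; 0 \<le> s; 0 \<le> t\<rbrakk> \<Longrightarrow> s *\<^sub>R x + t *\<^sub>R y \<in> C"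
  by (simp add: C_add C_scale)

lemma C_pointed: assumes "x \<in> C" "- x \<in> C" shows "x = 0"
proof -
  obtain c where c: "\<forall>a\<in>\<Delta>. 0 \<le> c a" "x = (\<Sum>a\<in>\<Delta>. c a *\<^sub>R a)" by (rule C_E[OF assms(1)])
  obtain d where d: "\<forall>a\<in>\<Delta>. 0 \<le> d a" "- x = (\<Sum>a\<in>\<Delta>. d a *\<^sub>R a)" by (rule C_E[OF assms(2)])
  have "(\<Sum>a\<in>\<Delta>. (c a + d a) *\<^sub>R a)
      = (\<Sum>a\<in>\<Delta>. c a *\<^sub>R a) + (\<Sum>a\<in>\<Delta>. d a *\<^sub>R a)"
    by (simp add: scaleR_left_distrib sum.distrib)
  also have "\<dots> = x + - x" unfolding c(2)[symmetric] d(2)[symmetric] by (rule HOL.refl)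
  also have "\<dots> = 0" by simp
  finally have "\<forall>a\<in>\<Delta>. c a + d a = 0" by (rule basis_pos_indep[of "\<lambda>a. c a + d a", rotated]) (simp add: c(1) d(1))
  then have "c a = 0" if "a \<in> \<Delta>" for a using c(1) d(1) that by fastforce
  then show "x = 0" unfolding c(2) by (intro sum.neutral) simp
qed

lemma basis_C: "a \<in> \<Delta> \<Longrightarrow> a \<in> C"
  unfolding nonneg_cone_def by (intro CollectI exI[of _ "{a}"] exI[of _ "\<lambda>_. 1"]) simp

section \<open>Every root is positive or negative\<close>

text \<open>
  The proof that \<open>g a\<close> is positive or negative is by induction on the word length of \<open>g\<close> in the simple
  reflections, and reduces to the dihedral groups generated by two of them.
\<close>
definition len :: "('v \<Rightarrow> 'v) \<Rightarrow> nat" where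
  "len g = (LEAST n. \<exists>u\<in>lists \<Delta>. length u = n \<and> act u = g)"

lemma len_le: "u \<in> lists \<Delta> \<Longrightarrow> len (act u) \<le> length u"
  unfolding len_def by (rule Least_le) auto

lemma len_attained:
  assumes "g \<in> G" obtains u where "u \<in> lists \<Delta>" "length u = len g" "act u = g"
proof -
  have "\<exists>n. \<exists>u\<in>lists \<Delta>. length u = n \<and> act u = g" using assms by (auto simp: G_def)
  from LeastI_ex[OF this] show thesis using that unfolding len_def by blast
qed

lemma len_comp_act:
  assumes "g \<in> G" "u \<in> lists \<Delta>" shows "len (g \<circ> act u) \<le> len g + length u"
proof -
  obtain w where w: "w \<in> lists \<Delta>" "length w = len g" "act w = g" using len_attained assms(1) by blast
  then have "w @ u \<in> lists \<Delta>" using assms(2) by simp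
  from len_le[OF this] w show ?thesis by (simp add: act_append)
qed

text \<open>
  The word of length \<open>n\<close> in \<open>a\<close> and \<open>b\<close> that alternates and ends with \<open>b\<close>. It grows at its left end,
  where the parity of the length decides on the next letter.
\<close>
fun alternating :: "'v \<Rightarrow> 'v \<Rightarrow> nat \<Rightarrow> 'v list" where
  "alternating a b 0 = []"
| "alternating a b (Suc n) = (if even n then b else a) # alternating a b n"

lemma length_alternating [simp]: "length (alternating a b n) = n"
  by (induction n) auto

lemma alternating_lists: "\<lbrakk>a \<in> \<Delta>; b \<in> \<Delta>\<rbrakk> \<Longrightarrow> alternating a b n \<in> lists \<Delta>"
  by (induction n) auto

lemma alternating_suffix: 
  "a \<in> \<Delta> \<Longrightarrow> b \<in> \<Delta> \<Longrightarrow> \<exists>u\<in>lists \<Delta>. length u = i \<and> alternating a b (i + j) = u @ alternating a b j"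
proof (induction i)
  case (Suc i)
  then obtain u where "u \<in> lists \<Delta>" "length u = i" "alternating a b (i + j) = u @ alternating a b j" by auto
  then show ?case using Suc.prems
    by (intro bexI[of _ "(if even (i + j) then b else a) # u"]) auto
qed simp

lemma act_alternating:
  assumes "a \<in> \<Delta>" "b \<in> \<Delta>" "B a b = - c"
  shows "act (alternating a b n) a =
    (if even n then sine_ratio c (Suc n) *\<^sub>R a + sine_ratio c n *\<^sub>R b
     else sine_ratio c n *\<^sub>R a + sine_ratio c (Suc n) *\<^sub>R b)"
proof (induction n)
  case (Suc n)
  have B: "B b a = - c" "B a a = 1" "B b b = 1" using assms form_sym[of a b] basis_norm by auto
  have 1: "refl b (x *\<^sub>R a + y *\<^sub>R b) = x *\<^sub>R a + (2 * c * x - y) *\<^sub>R b"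
    and 2: "refl a (x *\<^sub>R a + y *\<^sub>R b) = (2 * c * y - x) *\<^sub>R a + y *\<^sub>R b" for x y
    using B assms(3) by (simp_all add: refl_apply form_expand algebra_simps scaleR_twice)
  show ?case using Suc by (simp add: 1 2)
qed simp

lemma basis_form_le_0: "\<lbrakk>a \<in> \<Delta>; b \<in> \<Delta>; a \<noteq> b\<rbrakk> \<Longrightarrow> B a b \<le> 0"
proof -
  assume "a \<in> \<Delta>" "b \<in> \<Delta>" "a \<noteq> b"
  then consider "B a b \<le> - 1" | k :: nat where "2 \<le> k" "B a b = - cos (pi / real k)"
    using basis_form by blast
  then show ?thesis
  proof cases
    case 2
    then have "0 \<le> cos (pi / real k)" using pi_div_bounds[OF 2(1)] by (intro cos_ge_zero) linarith+
    then show ?thesis using 2 by simp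
  qed simp
qed

text \<open>
  The alternating word of length \<open>k - 1\<close> maps \<open>a\<close> to one of the two simple roots, because the
  coefficients are \<open>sin (k t) / sin t = 0\<close> and \<open>sin ((k - 1) t) / sin t = 1\<close> for \<open>t = \<pi> / k\<close>. Hence it
  conjugates the reflection in \<open>a\<close> to a simple reflection. This is the braid relation.
\<close>
lemma act_alternating_longest:
  assumes ab: "a \<in> \<Delta>" "b \<in> \<Delta>" and k: "2 \<le> k" "B a b = - cos (pi / real k)"
  shows "act (alternating a b k) = act (alternating a b (k - 1)) \<circ> refl a"
proof -
  let ?t = "pi / real k" and ?X = "act (alternating a b (k - 1))"
  define f where "f = (if even (k - 1) then b else a)"
  have k1: "Suc (k - 1) = k" using k by simp
  have sin: "0 < sin ?t" using pi_div_bounds[OF k(1)] by (intro sin_gt_zero) auto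
  have "sin ?t * sine_ratio (cos ?t) k = 0"
    using k unfolding sine_ratio_cos by simp
  moreover have "sin ?t * sine_ratio (cos ?t) (k - 1) = sin ?t"
  proof -
    have "real (k - 1) * ?t = pi - ?t" using k by (simp add: field_simps of_nat_diff)
    then show ?thesis unfolding sine_ratio_cos by simp
  qed
  ultimately have "sine_ratio (cos ?t) k = 0" "sine_ratio (cos ?t) (k - 1) = 1" using sin by auto
  then have Xa: "?X a = f"
    using act_alternating[OF ab, of "cos ?t" "k - 1"] k k1 by (auto simp: f_def)
  have G: "?X \<in> G" using alternating_lists ab by (auto simp: G_def)
  obtain h where h: "h \<in> G" "\<forall>v. h (?X v) = v" "\<forall>v. ?X (h v) = v" using inverse_G[OF G] by auto
  have "refl f \<circ> ?X = ?X \<circ> refl a"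
    unfolding Xa[symmetric] refl_image[OF G h(1) spec[OF h(3)]] using h(2) by auto
  moreover have "alternating a b k = f # alternating a b (k - 1)"
    using k1 alternating.simps(2)[of a b "k - 1"] by (simp add: f_def)
  ultimately show ?thesis by simp
qed

text \<open>
  Split \<open>g = v u\<close> with lengths adding up, where \<open>u\<close> is alternating in \<open>a\<close> and \<open>b\<close>, ends with a last
  letter \<open>b\<close> of a reduced word of \<open>g\<close>, and is as long as possible. Then neither \<open>a\<close> nor \<open>b\<close> shortens
  \<open>v\<close> on the right, so that \<open>v a\<close> and \<open>v b\<close> are positive by induction. The coefficients of \<open>u a\<close> with
  respect to \<open>a\<close> and \<open>b\<close> are nonnegative, because a word \<open>u\<close> that has reached the length in the braid
  relation could be rewritten to end with \<open>a\<close>, and \<open>g\<close> would become shorter on multiplication by \<open>a\<close>.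
\<close>
theorem length_increase_positive:
  "\<lbrakk>g \<in> G; a \<in> \<Delta>; len g \<le> len (g \<circ> refl a)\<rbrakk> \<Longrightarrow> g a \<in> C"
proof (induction "len g" arbitrary: g a rule: less_induct)
  case less
  obtain u where u: "u \<in> lists \<Delta>" "length u = len g" "act u = g" using len_attained less.prems by blast
  show ?case
  proof (cases "u = []")
    case True
    then have "g = id" using u by simp
    then show ?thesis using basis_C less.prems by simp
  next
    case False
    then obtain u' b where ub: "u = u' @ [b]" by (metis rev_exhaust)
    have b: "b \<in> \<Delta>" and u': "u' \<in> lists \<Delta>" "act u' \<in> G" using u ub by (auto simp: G_def)
    have inv: "h \<circ> refl x \<circ> refl x = h" if "x \<in> \<Delta>" for x h
      using refl_refl basis_norm that by (auto simp: fun_eq_iff)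
    have g: "g = act u' \<circ> refl b" using u(3) ub by (simp add: act_append)
    have "len (g \<circ> refl b) < len g"
      using len_le[OF u'(1)] u(2) ub unfolding g inv[OF b] by simp
    then have ab: "a \<noteq> b" using less.prems by auto
    define Q where "Q n \<longleftrightarrow> (\<exists>v\<in>G. g = v \<circ> act (alternating a b n) \<and> len v + n = len g)" for n
    have "len g \<le> len (act u') + 1" using len_comp_act[OF u'(2), of "[b]"] b g by simp
    then have Q1: "Q 1" using len_le[OF u'(1)] u(2) ub u'(2) g unfolding Q_def by (auto intro!: bexI[of _ "act u'"])
    have "Q n \<Longrightarrow> n \<le> len g" for n by (auto simp: Q_def)
    then obtain n where n: "Q n" "\<And>m. Q m \<Longrightarrow> m \<le> n"
      using Q1 GreatestI_nat[of Q 1 "len g"] Greatest_le_nat[of Q _ "len g"] by blast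
    have n1: "1 \<le> n" using n(2) Q1 by blast
    obtain v where v: "v \<in> G" "g = v \<circ> act (alternating a b n)" "len v + n = len g"
      using n(1) by (auto simp: Q_def)
    have v_pos: "v x \<in> C" if x: "x \<in> {a, b}" for x
    proof (rule less.hyps[of v x])
      show "len v < len g" using v(3) n1 by simp
      show "v \<in> G" by (rule v(1))
      show "x \<in> \<Delta>" using x b less.prems(2) by auto
      have vx: "v \<circ> refl x \<in> G" by (intro comp_G refl_basis_G v(1) \<open>x \<in> \<Delta>\<close>)
      show "len v \<le> len (v \<circ> refl x)"
      proof (rule ccontr)
        assume "\<not> ?thesis"
        then have shorter: "len (v \<circ> refl x) < len v" by simp
        show False
        proof (cases "x = (if even n then b else a)")
          case True
          then have "g = (v \<circ> refl x) \<circ> act (alternating a b (Suc n))"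
            unfolding v(2) using inv[OF \<open>x \<in> \<Delta>\<close>, of v] by (simp add: o_assoc)
          moreover from this have "len g \<le> len (v \<circ> refl x) + Suc n"
            using len_comp_act[OF vx alternating_lists[OF less.prems(2) b]] by (metis length_alternating)
          ultimately have "Q (Suc n)" unfolding Q_def using vx v(3) shorter by (auto intro!: bexI[of _ "v \<circ> refl x"])
          then show False using n(2) by fastforce
        next
          case False
          obtain k where k: "n = Suc k" using n1 by (cases n) auto
          then have "g = (v \<circ> refl x) \<circ> act (alternating a b k)"
            unfolding v(2) using False x by (auto simp: o_assoc)
          then have "len g \<le> len (v \<circ> refl x) + k"
            using len_comp_act[OF vx alternating_lists[OF less.prems(2) b]] by (metis length_alternating)
          then show False using v(3) shorter k by simp
        qed
      qed
    qed
    define c where "c = - B a b"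
    have coeffs: "0 \<le> sine_ratio c n \<and> 0 \<le> sine_ratio c (Suc n)"
    proof -
      consider "1 \<le> c" | k :: nat where "2 \<le> k" "B a b = - cos (pi / real k)"
        using basis_form[OF less.prems(2) b ab] unfolding c_def by fastforce
      then show ?thesis
      proof cases
        case 1
        then show ?thesis using sine_ratio_increases[of c n] by linarith
      next
        case (2 k)
        have "n < k"
        proof (rule ccontr)
          assume "\<not> n < k"
          then have "n = (n - k) + k" by simp
          then obtain p where p: "p \<in> lists \<Delta>" "length p = n - k"
            "alternating a b n = p @ alternating a b k"
            using alternating_suffix[OF less.prems(2) b] by metis
          let ?w = "p @ alternating a b (k - 1)"
          have "g = v \<circ> act ?w \<circ> refl a"
            unfolding v(2) p(3) act_append act_alternating_longest[OF less.prems(2) b 2] by (simp add: o_assoc)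
          then have gw: "g \<circ> refl a = v \<circ> act ?w" using inv[OF less.prems(2)] by metis
          have "?w \<in> lists \<Delta>" using p(1) alternating_lists[OF less.prems(2) b] by simp
          then have "len (g \<circ> refl a) \<le> len v + length ?w" unfolding gw by (rule len_comp_act[OF v(1)])
          also have "length ?w = n - k + (k - 1)" using p(2) by simp
          finally show False using less.prems(3) v(3) \<open>\<not> n < k\<close> 2(1) by linarith
        qed
        let ?t = "pi / real k"
        have c: "c = cos ?t" using 2 by (simp add: c_def)
        have sin: "0 < sin ?t" using pi_div_bounds[OF 2(1)] by (intro sin_gt_zero) auto
        have "0 \<le> sine_ratio c j" if "j \<le> k" for j
        proof -
          have "0 \<le> sin (real j * ?t)" using that 2 by (intro sin_ge_zero) (simp_all add: field_simps)
          then show ?thesis using sin unfolding c sine_ratio_cos[symmetric] by (simp add: zero_le_mult_iff)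
        qed
        then show ?thesis using \<open>n < k\<close> by simp
      qed
    qed
    have "g a = v (act (alternating a b n) a)" unfolding v(2) by simp
    then show ?thesis
      using coeffs v_pos linear_G[OF v(1)] act_alternating[OF less.prems(2) b, of c n]
      by (simp add: c_def linear_add linear_cmul C_combine)
  qed
qed

lemma root_sign: "x \<in> roots \<Longrightarrow> x \<in> C \<or> - x \<in> C"
proof -
  assume "x \<in> roots"
  then obtain g a where x: "x = g a" "g \<in> G" "a \<in> \<Delta>" by (auto simp: roots_def)
  show ?thesis
  proof (cases "len g \<le> len (g \<circ> refl a)")
    case True
    then show ?thesis using length_increase_positive[OF x(2,3)] x(1) by simp
  next
    case False
    have G: "g \<circ> refl a \<in> G" by (intro comp_G refl_basis_G x)
    have "g \<circ> refl a \<circ> refl a = g" using refl_refl basis_norm x(3) by (auto simp: fun_eq_iff)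
    then have "(g \<circ> refl a) a \<in> C" using length_increase_positive[OF G x(3)] False by simp
    then show ?thesis using x refl_self basis_norm linear_neg[OF linear_G[OF x(2)]] by simp
  qed
qed

lemma root_not_both: "\<lbrakk>x \<in> roots; x \<in> C\<rbrakk> \<Longrightarrow> - x \<notin> C"
  using C_pointed root_nonzero by blast

text \<open>
  The simple roots need not be linearly independent, but each of them spans an extreme ray of the cone:
  pairing a decomposition with \<open>a\<close> and using that distinct simple roots have nonpositive form turns it
  into a nonnegative linear relation.
\<close>
lemma basis_extreme:
  assumes "a \<in> \<Delta>" "x \<in> C" "y \<in> C" "x + y = t *\<^sub>R a"
  shows "\<exists>s\<ge>0. x = s *\<^sub>R a"
proof -
  obtain c where c: "\<forall>r\<in>\<Delta>. 0 \<le> c r" "x = (\<Sum>r\<in>\<Delta>. c r *\<^sub>R r)" by (rule C_E[OF assms(2)])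
  obtain d where d: "\<forall>r\<in>\<Delta>. 0 \<le> d r" "y = (\<Sum>r\<in>\<Delta>. d r *\<^sub>R r)" by (rule C_E[OF assms(3)])
  define e where "e r = (if r = a then c a + d a - t else c r + d r)" for r
  have "(\<Sum>r\<in>\<Delta>. e r *\<^sub>R r) = (\<Sum>r\<in>\<Delta>. c r *\<^sub>R r + d r *\<^sub>R r - (if r = a then t *\<^sub>R a else 0))"
    by (intro sum.cong) (auto simp: e_def algebra_simps)
  also have "\<dots> = x + y - t *\<^sub>R a"
    using finite_basis assms(1) unfolding c(2) d(2) by (simp add: sum_subtractf sum.distrib)
  finally have e0: "(\<Sum>r\<in>\<Delta>. e r *\<^sub>R r) = 0" using assms(4) by simp
  have "B (\<Sum>r\<in>\<Delta>. e r *\<^sub>R r) a = (\<Sum>r\<in>\<Delta>. e r * B r a)"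
  proof -
    have lin: "linear (\<lambda>v. B v a)" using form_bilinear by (simp add: bilinear_def)
    show ?thesis unfolding linear_sum[OF lin] by (simp add: form_expand)
  qed
  also have "\<dots> = e a + (\<Sum>r\<in>\<Delta> - {a}. e r * B r a)"
    using finite_basis assms(1) basis_norm by (simp add: sum.remove)
  finally have "e a = - (\<Sum>r\<in>\<Delta> - {a}. e r * B r a)" using e0 by (simp add: form_expand)
  moreover have "(\<Sum>r\<in>\<Delta> - {a}. e r * B r a) \<le> 0"
    using c(1) d(1) assms(1) basis_form_le_0 by (intro sum_nonpos mult_nonneg_nonpos) (auto simp: e_def)
  ultimately have "\<forall>r\<in>\<Delta>. 0 \<le> e r" using c(1) d(1) by (auto simp: e_def)
  then have e: "\<forall>r\<in>\<Delta>. e r = 0" by (rule basis_pos_indep) (rule e0)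
  have "c r = 0" if "r \<in> \<Delta>" "r \<noteq> a" for r
    using bspec[OF e that(1)] bspec[OF c(1) that(1)] bspec[OF d(1) that(1)] that(2) by (simp add: e_def)
  then have "x = (\<Sum>r\<in>\<Delta>. if r = a then c a *\<^sub>R a else 0)"
    unfolding c(2) by (intro sum.cong) auto
  then have "x = c a *\<^sub>R a" using finite_basis assms(1) by simp
  then show ?thesis using c(1) assms(1) by blast
qed

lemma basis_refl_positive:
  assumes "a \<in> \<Delta>" "x \<in> roots" "x \<in> C" "x \<noteq> a"
  shows "refl a x \<in> C"
proof (rule ccontr)
  assume "refl a x \<notin> C"
  then have "- refl a x \<in> C" using root_sign[OF refl_root[OF basis_roots[OF assms(1)] assms(2)]] by simp
  moreover have "x + - refl a x = (2 * B a x) *\<^sub>R a" by (simp add: refl_apply)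
  ultimately obtain s where s: "0 \<le> s" "x = s *\<^sub>R a" using basis_extreme[OF assms(1,3)] by metis
  then have "s * s = 1" using root_norm[OF assms(2)] basis_norm[OF assms(1)] by (simp add: form_expand)
  then have "s = 1" using s(1) power2_eq_1_iff[of s] by (simp add: power2_eq_square)
  then show False using s assms(4) by simp
qed

lemma finite_inversions: "g \<in> G \<Longrightarrow> finite {x \<in> roots. x \<in> C \<and> - g x \<in> C}"
proof -
  have "finite {x \<in> roots. x \<in> C \<and> - act u x \<in> C}" if "u \<in> lists \<Delta>" for u
    using that
  proof (induction u)
    case Nil
    have "{x \<in> roots. x \<in> C \<and> - act [] x \<in> C} = {}" using root_not_both by auto
    then show ?case by (simp only: finite.emptyI)
  next
    case (Cons a u)
    then have G: "act u \<in> G" "a \<in> \<Delta>" by (auto simp: G_def)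
    obtain h where h: "\<forall>v. h (act u v) = v" using inverse_G[OF G(1)] by auto
    have "{x \<in> roots. x \<in> C \<and> - act (a # u) x \<in> C} \<subseteq> {x \<in> roots. x \<in> C \<and> - act u x \<in> C} \<union> {h a}"
    proof
      fix x assume x: "x \<in> {x \<in> roots. x \<in> C \<and> - act (a # u) x \<in> C}"
      have r: "act u x \<in> roots" using G_roots[OF G(1)] x by simp
      have "refl a (act u x) \<notin> C" using x root_not_both refl_root[OF basis_roots[OF G(2)] r] by auto
      then have "act u x = a \<or> - act u x \<in> C" using basis_refl_positive[OF G(2) r] root_sign[OF r] by auto
      then show "x \<in> {x \<in> roots. x \<in> C \<and> - act u x \<in> C} \<union> {h a}" using x h by auto
    qed
    then show ?case using Cons by (auto intro: finite_subset)
  qed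
  then show "g \<in> G \<Longrightarrow> ?thesis" by (auto simp: G_def)
qed

section \<open>Dominance\<close>

text \<open>
  Dominance, stated for arbitrary vectors and with \<open>g\<close> in the place of the inverse of a group element.
\<close>
definition dom :: "'v \<Rightarrow> 'v \<Rightarrow> bool" where
  "dom x y \<longleftrightarrow> (\<forall>g\<in>G. - g x \<in> C \<longrightarrow> - g y \<in> C)"

lemma domD: "\<lbrakk>dom x y; g \<in> G; - g x \<in> C\<rbrakk> \<Longrightarrow> - g y \<in> C"
  by (simp add: dom_def)

lemma dom_id: "\<lbrakk>dom x y; - x \<in> C\<rbrakk> \<Longrightarrow> - y \<in> C"
  using domD[OF _ id_G] by simp

lemma dom_trans: "\<lbrakk>dom x y; dom y z\<rbrakk> \<Longrightarrow> dom x z"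
  by (simp add: dom_def)

lemma dom_act: assumes "dom x y" "h \<in> G" shows "dom (h x) (h y)"
  unfolding dom_def
proof (intro ballI impI)
  fix g assume "g \<in> G" "- g (h x) \<in> C"
  then show "- g (h y) \<in> C" using domD[OF assms(1) comp_G[OF \<open>g \<in> G\<close> assms(2)]] by simp
qed

lemma dom_neg: assumes "x \<in> roots" "y \<in> roots" "dom x y" shows "dom (- y) (- x)"
  unfolding dom_def
proof (intro ballI impI)
  fix g assume g: "g \<in> G" "- g (- y) \<in> C"
  then have "g y \<in> C" by (simp add: linear_neg[OF linear_G])
  then have "- g x \<notin> C" using domD[OF assms(3) g(1)] root_not_both[OF G_roots[OF g(1) assms(2)]] by auto
  then show "- g (- x) \<in> C"
    using root_sign[OF G_roots[OF g(1) assms(1)]] by (simp add: linear_neg[OF linear_G[OF g(1)]])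
qed

text \<open>
  The sequence of roots \<open>x, y, \<dots>\<close> in which consecutive members are images of \<open>(x, y)\<close> under the dihedral
  group of \<open>x\<close> and \<open>y\<close>, up to the simultaneous change of order and sign (\<open>chain_pair\<close>). This change
  preserves dominance (\<open>dom_neg\<close>), so each member dominates the next if \<open>x\<close> dominates \<open>y\<close>.
\<close>
fun chain :: "'v \<Rightarrow> 'v \<Rightarrow> nat \<Rightarrow> 'v" where
  "chain x y 0 = x"
| "chain x y (Suc 0) = y"
| "chain x y (Suc (Suc n)) = (2 * B x y) *\<^sub>R chain x y (Suc n) - chain x y n"

lemma chain_eq:
  "chain x y (Suc n) = sine_ratio (B x y) (Suc n) *\<^sub>R y - sine_ratio (B x y) n *\<^sub>R x"
proof (induction n rule: induct_nat_012)
  case 1 then show ?case by simp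
next
  case (ge2 n)
  show ?case
    unfolding chain.simps(3)[of x y "Suc n"] ge2 by (simp add: algebra_simps)
qed simp

lemma chain_pair:
  assumes "x \<in> roots" "y \<in> roots"
  shows "\<exists>g\<in>G. (chain x y n = g x \<and> chain x y (Suc n) = g y) \<or>
    (chain x y n = - g y \<and> chain x y (Suc n) = - g x)"
proof (induction n)
  case 0
  show ?case using id_G by (intro bexI[of _ id]) auto
next
  case (Suc n)
  then obtain g where g: "g \<in> G"
    and d: "(chain x y n = g x \<and> chain x y (Suc n) = g y) \<or> (chain x y n = - g y \<and> chain x y (Suc n) = - g x)"
    by auto
  note lin = linear_diff[OF linear_G[OF g]] linear_cmul[OF linear_G[OF g]] linear_neg[OF linear_G[OF g]]
  have norm: "B x x = 1" "B y y = 1" using root_norm assms by auto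
  from d show ?case
  proof
    assume d: "chain x y n = g x \<and> chain x y (Suc n) = g y"
    show ?thesis
    proof (intro bexI[of _ "g \<circ> refl y"] disjI2 conjI)
      show "chain x y (Suc n) = - (g \<circ> refl y) y" using d norm by (simp add: refl_self lin)
      show "chain x y (Suc (Suc n)) = - (g \<circ> refl y) x" using d form_sym[of x y] by (simp add: refl_apply lin)
    qed (intro comp_G g refl_root_G assms)
  next
    assume d: "chain x y n = - g y \<and> chain x y (Suc n) = - g x"
    show ?thesis
    proof (intro bexI[of _ "g \<circ> refl x"] disjI1 conjI)
      show "chain x y (Suc n) = (g \<circ> refl x) x" using d norm by (simp add: refl_self lin)
      show "chain x y (Suc (Suc n)) = (g \<circ> refl x) y" using d by (simp add: refl_apply lin)
    qed (intro comp_G g refl_root_G assms)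
  qed
qed

lemma chain_root:
  assumes "x \<in> roots" "y \<in> roots" shows "chain x y n \<in> roots"
  using chain_pair[OF assms, of n] G_roots assms neg_root by metis

lemma chain_dom:
  assumes "x \<in> roots" "y \<in> roots" "dom x y" shows "dom (chain x y n) (chain x y (Suc n))"
proof -
  obtain g where "g \<in> G" "(chain x y n = g x \<and> chain x y (Suc n) = g y) \<or>
    (chain x y n = - g y \<and> chain x y (Suc n) = - g x)" using chain_pair[OF assms(1,2)] by metis
  then show ?thesis
    using dom_act[OF assms(3), of g] dom_neg[OF G_roots[OF _ assms(1)] G_roots[OF _ assms(2)], of g g] by auto
qed

lemma chain_inj:
  assumes "x \<in> roots" "y \<in> roots" "1 \<le> B x y" "x \<noteq> y"
  shows "inj (\<lambda>n. chain x y (Suc n))"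
proof (rule linorder_injI)
  fix m n :: nat assume mn: "m < n"
  let ?U = "sine_ratio (B x y)"
  show "chain x y (Suc m) \<noteq> chain x y (Suc n)"
  proof
    assume "chain x y (Suc m) = chain x y (Suc n)"
    then have e: "(?U (Suc n) - ?U (Suc m)) *\<^sub>R y = (?U n - ?U m) *\<^sub>R x"
      unfolding chain_eq by (simp only: scaleR_diff_left) (simp add: algebra_simps)
    have "0 < ?U (Suc n) - ?U (Suc m)"
      using sine_ratio_strict_mono[OF assms(3)] mn by (simp add: strict_mono_def)
    then have "y = (1 / (?U (Suc n) - ?U (Suc m))) *\<^sub>R ((?U (Suc n) - ?U (Suc m)) *\<^sub>R y)"
      by (simp del: sine_ratio.simps)
    then obtain t where t: "y = t *\<^sub>R x" unfolding e scaleR_scaleR by blast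
    have "t * t = 1" "1 \<le> t"
      using root_norm[OF assms(1)] root_norm[OF assms(2)] assms(3) t by (simp_all add: form_expand)
    then have "t = 1" by (smt (verit) mult_less_cancel_left2)
    then show False using t assms(4) by simp
  qed
qed

text \<open>
  A sequence of positive vectors cannot rotate. Taking every second member replaces \<open>b = cos t\<close> by
  \<open>2 b\<^sup>2 - 1 = cos (2 t)\<close> and at least doubles \<open>1 - b\<close> as long as \<open>b > 0\<close>; once \<open>b \<le> 0\<close>, the recursion
  expresses a negative vector as a positive one.
\<close>
lemma no_slow_chain:
  fixes v :: "nat \<Rightarrow> 'v"
  assumes pos: "\<And>n. v n \<in> C" "\<And>n. v n \<noteq> 0"
  shows "\<lbrakk>1 \<le> (1 - b) * 2 ^ k; b < 1; \<And>n. v (n + 2 * s) + v n = (2 * b) *\<^sub>R v (n + s)\<rbrakk> \<Longrightarrow> False"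
proof -
  have stop: False if b: "b \<le> 0" and rec: "\<And>n. v (n + 2 * s) + v n = (2 * b) *\<^sub>R v (n + s)" for b s
  proof -
    have "- v 0 = v (2 * s) + (- 2 * b) *\<^sub>R v s" using rec[of 0] by (simp add: algebra_simps eq_neg_iff_add_eq_0)
    also have "\<dots> \<in> C" using pos b by (intro C_add C_scale) auto
    finally show False using C_pointed[OF pos(1)] pos(2) by blast
  qed
  show "\<lbrakk>1 \<le> (1 - b) * 2 ^ k; b < 1; \<And>n. v (n + 2 * s) + v n = (2 * b) *\<^sub>R v (n + s)\<rbrakk> \<Longrightarrow> False"
  proof (induction k arbitrary: b s)
    case 0
    then show False using stop[of b s] by simp
  next
    case (Suc k)
    show False
    proof (cases "b \<le> 0")
      case True
      then show False using stop Suc.prems(3) by blast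
    next
      case False
      let ?b = "2 * b\<^sup>2 - 1"
      have "2 * (1 - b) \<le> 1 - ?b"
      proof -
        have "0 \<le> (1 - b) * b" using False Suc.prems(2) by (intro mult_nonneg_nonneg) auto
        then show ?thesis by (simp add: power2_eq_square algebra_simps)
      qed
      then have "2 * (1 - b) * 2 ^ k \<le> (1 - ?b) * 2 ^ k" by (intro mult_right_mono) auto
      moreover have "(1 - b) * 2 ^ Suc k = 2 * (1 - b) * 2 ^ k" by simp
      ultimately have "1 \<le> (1 - ?b) * 2 ^ k" using Suc.prems(1) by linarith
      moreover have "?b < 1" using False Suc.prems(2) abs_square_less_1[of b] by simp
      moreover have "v (n + 2 * (2 * s)) + v n = (2 * ?b) *\<^sub>R v (n + 2 * s)" for n
      proof -
        have eqs: "n + 2 * s + 2 * s = n + 4 * s" "n + 2 * s + s = n + 3 * s"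
          "n + s + 2 * s = n + 3 * s" "n + s + s = n + 2 * s" by auto
        note 1 = Suc.prems(3)[of "n + 2 * s", unfolded eqs] and 2 = Suc.prems(3)[of "n + s", unfolded eqs]
        have "v (n + 4 * s) + v n + 2 *\<^sub>R v (n + 2 * s) =
            (v (n + 4 * s) + v (n + 2 * s)) + (v (n + 2 * s) + v n)" by (simp add: scaleR_2)
        also have "\<dots> = (2 * b) *\<^sub>R (v (n + 3 * s) + v (n + s))"
          unfolding 1 Suc.prems(3)[of n] scaleR_add_right by (rule HOL.refl)
        also have "\<dots> = (2 * ?b) *\<^sub>R v (n + 2 * s) + 2 *\<^sub>R v (n + 2 * s)"
          unfolding 2 scaleR_scaleR scaleR_add_left[symmetric] by (simp add: power2_eq_square algebra_simps)
        finally show ?thesis by (simp add: mult.assoc[symmetric])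
      qed
      ultimately show False by (rule Suc.IH)
    qed
  qed
qed

text \<open>
  Along the chain of \<open>x\<close> and \<open>y\<close>, a member after a negative one is negative. So the members are all
  positive, or they are negative from some point on; neither is possible for a rotation.
\<close>
lemma dom_form_ge_1:
  assumes "x \<in> roots" "y \<in> roots" "dom x y" shows "1 \<le> B x y"
proof (rule ccontr)
  assume "\<not> 1 \<le> B x y"
  then have b: "B x y < 1" by simp
  then obtain k :: nat where "1 / (1 - B x y) < 2 ^ k" using real_arch_pow[of 2] by auto
  then have k: "1 \<le> (1 - B x y) * 2 ^ k" using b by (simp add: field_simps)
  have rec: "chain x y (n + 2 * 1) + chain x y n = (2 * B x y) *\<^sub>R chain x y (n + 1)" for n by simp
  have nz: "chain x y n \<noteq> 0" for n using root_nonzero[OF chain_root[OF assms(1,2)]] .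
  show False
  proof (cases "\<forall>n. chain x y n \<in> C")
    case True
    show False by (rule no_slow_chain[of "chain x y", OF _ nz k b rec]) (use True in blast)
  next
    case False
    then obtain J where "chain x y J \<notin> C" by blast
    then have J: "- chain x y J \<in> C" using root_sign[OF chain_root[OF assms(1,2)]] by blast
    have "- chain x y (J + n) \<in> C" for n
      by (induction n) (use J dom_id[OF chain_dom[OF assms]] in auto)
    moreover have "- chain x y (J + (n + 2 * 1)) + - chain x y (J + n) = (2 * B x y) *\<^sub>R (- chain x y (J + (n + 1)))" for n
      by simp
    ultimately show False using no_slow_chain[of "\<lambda>n. - chain x y (J + n)", OF _ _ k b, of 1] nz by simp
  qed
qed

text \<open>
  If all members of the chain were positive, they would be infinitely many inversions of the reflection
  in \<open>x\<close>, since \<open>x\<close> dominates them. At the first negative member the difference of consecutive members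
  is positive, and it increases in the other direction by \<open>(2 B(x, y) - 2)\<close> times a positive root.
\<close>
lemma dom_diff_pos:
  assumes x: "x \<in> roots" "x \<in> C" and y: "y \<in> roots" "y \<in> C" and "dom x y"
  shows "x - y \<in> C"
proof (cases "x = y")
  case True then show ?thesis using C_zero by simp
next
  case False
  have b: "1 \<le> B x y" by (rule dom_form_ge_1[OF x(1) y(1) assms(5)])
  have "\<exists>J. chain x y J \<notin> C"
  proof (rule ccontr)
    assume "\<not> ?thesis"
    then have C: "chain x y n \<in> C" for n by blast
    have dom: "dom x (chain x y (Suc n))" for n
    proof (induction n)
      case (Suc n)
      then show ?case by (rule dom_trans[OF _ chain_dom[OF x(1) y(1) assms(5)]])
    qed (simp add: assms(5))
    have "- refl x x \<in> C" using x refl_self root_norm by simp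
    then have "- refl x (chain x y (Suc n)) \<in> C" for n by (rule domD[OF dom refl_root_G[OF x(1)]])
    then have "range (\<lambda>n. chain x y (Suc n)) \<subseteq> {r \<in> roots. r \<in> C \<and> - refl x r \<in> C}"
      using C chain_root[OF x(1) y(1)] by blast
    then have "finite (range (\<lambda>n. chain x y (Suc n)))"
      using finite_inversions[OF refl_root_G[OF x(1)]] by (rule finite_subset)
    then show False using chain_inj[OF x(1) y(1) b False] finite_imageD by blast
  qed
  then obtain J where J: "chain x y J \<notin> C" "\<And>n. n < J \<Longrightarrow> chain x y n \<in> C"
    using exists_least_iff[of "\<lambda>J. chain x y J \<notin> C"] by blast
  have "J \<noteq> 0" using J(1) x by (metis chain.simps(1))
  then obtain i where i: "J = Suc i" by (cases J) auto
  have "chain x y (i - j) - chain x y (Suc (i - j)) \<in> C" if "j \<le> i" for j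
    using that
  proof (induction j)
    case 0
    have "- chain x y J \<in> C" using J(1) root_sign[OF chain_root[OF x(1) y(1)]] by blast
    then show ?case using C_add[of "chain x y i" "- chain x y J"] J(2)[of i] i by simp
  next
    case (Suc j)
    then obtain n where n: "i - Suc j = n" "i - j = Suc n" by (metis Suc_diff_Suc Suc_le_lessD)
    have "chain x y n - chain x y (Suc n) =
      (chain x y (Suc n) - chain x y (Suc (Suc n))) + (2 * B x y - 2) *\<^sub>R chain x y (Suc n)"
      by (simp add: algebra_simps scaleR_2)
    also have "\<dots> \<in> C"
    proof (rule C_add)
      show "chain x y (Suc n) - chain x y (Suc (Suc n)) \<in> C" using Suc n by simp
      have "chain x y (Suc n) \<in> C" using J(2)[of "Suc n"] n i by linarith
      then show "(2 * B x y - 2) *\<^sub>R chain x y (Suc n) \<in> C" using b by (intro C_scale) auto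
    qed
    finally show ?case unfolding n(1) .
  qed
  from this[of i] have "chain x y 0 - chain x y (Suc 0) \<in> C" by simp
  then show ?thesis by simp
qed

lemma dom_diff:
  assumes x: "x \<in> roots" and y: "y \<in> roots" and dom: "dom x y" and g: "g \<in> G"
  shows "g x - g y \<in> C"
proof -
  have r: "g x \<in> roots" "g y \<in> roots" using G_roots[OF g x] G_roots[OF g y] by simp_all
  have d: "dom (g x) (g y)" by (rule dom_act[OF dom g])
  consider "g x \<in> C" "g y \<in> C" | "g x \<in> C" "- g y \<in> C" | "- g x \<in> C" "- g y \<in> C"
    using root_sign[OF r(1)] root_sign[OF r(2)] dom_id[OF d] by blast
  then show ?thesis
  proof cases
    case 1 then show ?thesis using dom_diff_pos[OF r(1) _ r(2) _ d] by blast
  next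
    case 2 then show ?thesis using C_add[of "g x" "- g y"] by simp
  next
    case 3
    then show ?thesis
      using dom_diff_pos[OF neg_root[OF r(2)] _ neg_root[OF r(1)] _ dom_neg[OF r d]] by simp
  qed
qed

text \<open>
  If neither root dominates the other, then some \<open>k\<close> in the group makes two positive roots \<open>p\<close> and \<open>q\<close>
  with \<open>B(p, q) \<le> - 1\<close> negative. It makes all roots in the cone of \<open>p\<close> and \<open>q\<close> negative, and there are
  infinitely many of them.
\<close>
lemma dom_total:
  assumes x: "x \<in> roots" and y: "y \<in> roots" and b: "1 \<le> B x y"
  shows "dom x y \<or> dom y x"
proof (rule ccontr)
  assume neg: "\<not> ?thesis"
  then obtain g where g: "g \<in> G" "- g x \<in> C" "- g y \<notin> C" by (auto simp: dom_def)
  obtain h where h: "h \<in> G" "- h y \<in> C" "- h x \<notin> C" using neg by (auto simp: dom_def)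
  obtain g' where g': "g' \<in> G" "\<forall>v. g' (g v) = v" using inverse_G[OF g(1)] by auto
  have r: "g x \<in> roots" "g y \<in> roots" "h x \<in> roots" "h y \<in> roots"
    using G_roots[OF g(1) x] G_roots[OF g(1) y] G_roots[OF h(1) x] G_roots[OF h(1) y] by simp_all
  have pos: "g y \<in> C" "h x \<in> C" using root_sign[OF r(2)] root_sign[OF r(3)] g(3) h(3) by blast+
  let ?p = "- g y" and ?q = "- g x" and ?k = "h \<circ> g'"
  have k: "?k \<in> G" by (intro comp_G h g')
  have lin: "linear ?k" by (rule linear_G[OF k])
  have kp: "?k (g y) = h y" "?k ?q = - h x" using g'(2) linear_neg[OF lin, of "g x"] by simp_all
  have pq: "?p \<in> roots" "?q \<in> roots" "1 \<le> B ?p ?q" "?p \<noteq> ?q"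
  proof -
    show "1 \<le> B ?p ?q" using b form_sym[of x y] isometry_G[OF g(1), of y x] by (simp add: form_expand)
    have "x \<noteq> y" using neg by (auto simp: dom_def)
    then show "?p \<noteq> ?q" using g'(2) by (metis neg_equal_iff_equal)
  qed (use r neg_root in auto)
  have "chain ?p ?q (Suc n) \<in> {r \<in> roots. r \<in> C \<and> - ?k r \<in> C}" for n
  proof -
    define s t where "s = sine_ratio (B ?p ?q) (Suc n)" and "t = sine_ratio (B ?p ?q) n"
    have st: "0 \<le> s" "0 \<le> t" using sine_ratio_increases[OF pq(3)] unfolding s_def t_def by blast+
    have e: "chain ?p ?q (Suc n) = s *\<^sub>R ?q + t *\<^sub>R g y" unfolding chain_eq s_def t_def by simp
    have "- ?k (chain ?p ?q (Suc n)) = s *\<^sub>R h x + t *\<^sub>R (- h y)"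
      unfolding e linear_add[OF lin] linear_cmul[OF lin] kp by simp
    then have "- ?k (chain ?p ?q (Suc n)) \<in> C" using C_combine[OF pos(2) h(2) st] by (simp only:)
    moreover have "chain ?p ?q (Suc n) \<in> C" unfolding e by (rule C_combine[OF g(2) pos(1) st])
    ultimately show ?thesis using chain_root[OF pq(1,2)] by blast
  qed
  then have "range (\<lambda>n. chain ?p ?q (Suc n)) \<subseteq> {r \<in> roots. r \<in> C \<and> - ?k r \<in> C}"
    by (intro image_subsetI)
  then have "finite (range (\<lambda>n. chain ?p ?q (Suc n)))"
    by (rule finite_subset) (rule finite_inversions[OF k])
  then show False using chain_inj[OF pq] finite_imageD by blast
qed

definition nonsmall :: "'v \<Rightarrow> bool" where
  "nonsmall x \<longleftrightarrow> x \<in> roots \<and> x \<in> C \<and> (\<exists>y. y \<in> roots \<and> y \<in> C \<and> y \<noteq> x \<and> dom x y)"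

text \<open>
  Let \<open>x\<close> dominate \<open>y\<close>. If \<open>\<rho>\<close> and \<open>y\<close> have negative form, then \<open>s\<^sub>\<rho> y\<close> is positive and dominated by
  \<open>s\<^sub>\<rho> x\<close>. Otherwise the reflection does not decrease the form with \<open>y\<close>, and \<open>s\<^sub>\<rho> x\<close> dominates \<open>y\<close> itself:
  the opposite dominance would make \<open>x\<close> dominate \<open>s\<^sub>\<rho> x\<close>, but \<open>B(x, s\<^sub>\<rho> x) = 1 - 2 B(x, \<rho>)\<^sup>2 < 1\<close> if
  \<open>s\<^sub>\<rho>\<close> moves \<open>x\<close>.
\<close>
lemma nonsmall_refl:
  assumes ns: "nonsmall x" and \<rho>: "\<rho> \<in> roots" "\<rho> \<in> C" and le: "B x \<rho> \<le> 0"
  shows "nonsmall (refl \<rho> x)"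
proof (cases "B x \<rho> = 0")
  case True
  then show ?thesis using ns form_sym[of x \<rho>] by (simp add: refl_apply)
next
  case False
  obtain y where x: "x \<in> roots" "x \<in> C" and y: "y \<in> roots" "y \<in> C" "y \<noteq> x" "dom x y"
    using ns by (auto simp: nonsmall_def)
  define c where "c = - B x \<rho>"
  have c: "0 < c" using le False by (simp add: c_def)
  have B: "B x x = 1" "B \<rho> \<rho> = 1" "B \<rho> x = - c" using root_norm x \<rho> form_sym[of x \<rho>] by (auto simp: c_def)
  let ?x = "refl \<rho> x"
  have e: "?x = x + (2 * c) *\<^sub>R \<rho>" using B by (simp add: refl_apply)
  have xr: "?x \<in> roots" by (rule refl_root[OF \<rho>(1) x(1)])
  have xC: "?x \<in> C" unfolding e using c x \<rho> by (intro C_add C_scale) auto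
  have "B x ?x = 1 - 2 * c\<^sup>2" unfolding e using B form_sym[of x \<rho>] by (simp add: form_expand power2_eq_square)
  then have no: "\<not> dom x ?x" using dom_form_ge_1[OF x(1) xr] c by auto
  show ?thesis
  proof (cases "0 \<le> B \<rho> y")
    case True
    have "1 \<le> B x y" by (rule dom_form_ge_1[OF x(1) y(1) y(4)])
    then have "1 \<le> B ?x y" unfolding e using True c by (simp add: form_expand add_increasing2)
    then have "dom ?x y" using dom_total[OF xr y(1)] dom_trans[OF y(4), of ?x] no by blast
    moreover have "y \<noteq> ?x" using no y(4) by auto
    ultimately show ?thesis unfolding nonsmall_def using xr xC y by blast
  next
    case False
    let ?y = "refl \<rho> y"
    have "?y = y + (- 2 * B \<rho> y) *\<^sub>R \<rho>" by (simp add: refl_apply)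
    also have "\<dots> \<in> C" using False y \<rho> by (intro C_add C_scale) auto
    finally have "?y \<in> C" .
    moreover have "?y \<noteq> ?x" using y(3) refl_refl[OF B(2)] by metis
    ultimately show ?thesis
      unfolding nonsmall_def using xr xC refl_root[OF \<rho>(1) y(1)] dom_act[OF y(4) refl_root_G[OF \<rho>(1)]] by blast
  qed
qed

section \<open>Neighbours of a root that is not small\<close>

lemma chain_3: "chain x y 3 = (4 * (B x y)\<^sup>2 - 1) *\<^sub>R y - (2 * B x y) *\<^sub>R x"
  using chain_eq[of x y 2] by (simp add: eval_nat_numeral power2_eq_square algebra_simps)

lemma chain_4: "chain x y 4 = (8 * (B x y) ^ 3 - 4 * B x y) *\<^sub>R y - (4 * (B x y)\<^sup>2 - 1) *\<^sub>R x"
  using chain_eq[of x y 3] by (simp add: eval_nat_numeral power2_eq_square algebra_simps)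

text \<open>
  In the application, \<open>a\<close> and \<open>b\<close> are the canonical simple roots of a dihedral group of order \<open>2 m\<close> with
  \<open>m \<ge> 4\<close> even, \<open>c\<close> is \<open>cos (\<pi> / m)\<close>, and \<open>z\<close> is the longest element of this group. The element \<open>z\<close>
  has two purposes: it makes all roots of the set \<open>X\<close> below negative, so that \<open>X\<close> is finite, and
  adding the image under \<open>z\<close> to a vector cancels components in the plane of \<open>a\<close> and \<open>b\<close>.
\<close>
lemma neighbour_nonsmall:
  assumes a: "a \<in> roots" "a \<in> C" and b: "b \<in> roots" "b \<in> C"
    and ab: "B a b = - c" and c: "0 < c" "c < 1" "1 \<le> 2 * c\<^sup>2"
    and z: "z \<in> G" "z a = - a" "z b = - b" "\<And>v. \<exists>x y. z v - v = x *\<^sub>R a + y *\<^sub>R b"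
    and ns: "nonsmall a"
  shows "nonsmall (refl a b)"
proof -
  obtain d where d: "d \<in> roots" "d \<in> C" "d \<noteq> a" "dom a d" using ns by (auto simp: nonsmall_def)
  have dom_ad: "1 \<le> B a d" by (rule dom_form_ge_1[OF a(1) d(1,4)])
  have ba: "B b a = - c" using ab form_sym[of a b] by simp
  note norm = root_norm[OF a(1)] root_norm[OF b(1)]
  have S1: "c\<^sup>2 < 1" using c by (simp add: abs_square_less_1)
  have indep: "d \<noteq> x *\<^sub>R a + y *\<^sub>R b" for x y
  proof
    assume e: "d = x *\<^sub>R a + y *\<^sub>R b"
    have 1: "x\<^sup>2 - 2 * c * x * y + y\<^sup>2 = 1"
      using root_norm[OF d(1)] norm ab ba unfolding e by (simp add: form_expand power2_eq_square algebra_simps)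
    have 2: "1 \<le> x - c * y" using dom_ad norm ab unfolding e by (simp add: form_expand mult.commute)
    have "1 \<le> (x - c * y)\<^sup>2" using 2 by (simp add: one_le_power)
    moreover have "(x - c * y)\<^sup>2 + y\<^sup>2 * (1 - c\<^sup>2) = 1" using 1 by (simp add: power2_eq_square algebra_simps)
    ultimately have "y\<^sup>2 * (1 - c\<^sup>2) \<le> 0" by linarith
    then have y: "y = 0" using S1 by (auto simp: mult_le_0_iff)
    then have "x = 1" using 1 2 power2_eq_1_iff[of x] by auto
    then show False using e y d(3) by simp
  qed
  let ?\<gamma> = "refl a b"
  have \<gamma>: "?\<gamma> = b + (2 * c) *\<^sub>R a" using ab by (simp add: refl_apply)
  have \<gamma>r: "?\<gamma> \<in> roots" by (rule refl_root[OF a(1) b(1)])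
  have \<gamma>C: "?\<gamma> \<in> C" unfolding \<gamma> using a b c by (intro C_add C_scale) auto
  note lin = linear_add[OF linear_G[OF z(1)]] linear_cmul[OF linear_G[OF z(1)]] linear_diff[OF linear_G[OF z(1)]]
  have zd: "- z d \<in> C" using domD[OF d(4) z(1)] z(2) a(2) by simp

  \<comment> \<open>If \<open>\<kappa>\<close> dominated \<open>\<gamma>\<close>, then adding the images of \<open>\<kappa> - \<gamma>\<close> under \<open>id\<close> and \<open>z\<close> would show that
     \<open>d + z d\<close> is in the cone. The same sum for \<open>a - d\<close> shows that \<open>- (d + z d)\<close> is. So \<open>z d = - d\<close>, and
     \<open>d\<close> would lie in the plane of \<open>a\<close> and \<open>b\<close>.\<close>
  have candidate: "nonsmall ?\<gamma>"
    if \<kappa>: "\<kappa> \<in> roots" "\<kappa> \<in> C" "\<kappa> = s *\<^sub>R d + x *\<^sub>R a + y *\<^sub>R b" "0 < s" "1 \<le> B ?\<gamma> \<kappa>" for \<kappa> s x y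
  proof -
    have "\<not> dom \<kappa> ?\<gamma>"
    proof
      assume dom: "dom \<kappa> ?\<gamma>"
      have "(id \<kappa> - id ?\<gamma>) + (z \<kappa> - z ?\<gamma>) \<in> C"
        by (intro C_add dom_diff[OF \<kappa>(1) \<gamma>r dom] id_G z(1))
      moreover have "(id \<kappa> - id ?\<gamma>) + (z \<kappa> - z ?\<gamma>) = s *\<^sub>R (d + z d)"
        unfolding \<kappa>(3) \<gamma> by (simp add: lin z(2,3) algebra_simps)
      ultimately have "s *\<^sub>R (d + z d) \<in> C" by (simp only:)
      from C_scale[OF this, of "1 / s"] have 1: "d + z d \<in> C" using that(4) by simp
      have "(id a - id d) + (z a - z d) \<in> C"
        by (intro C_add dom_diff[OF a(1) d(1,4)] id_G z(1))
      then have "- (d + z d) \<in> C" by (simp add: z(2))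
      then have "d + z d = 0" by (rule C_pointed[OF 1])
      then have "z d = - d" by (simp add: eq_neg_iff_add_eq_0 add.commute)
      then have zz: "z d - d = (- 2) *\<^sub>R d" by (simp add: scaleR_2)
      obtain x y where "z d - d = x *\<^sub>R a + y *\<^sub>R b" using z(4) by blast
      then have "(- 1 / 2) *\<^sub>R (- 2) *\<^sub>R d = (- 1 / 2) *\<^sub>R (x *\<^sub>R a + y *\<^sub>R b)" unfolding zz by simp
      then have "d = (- x / 2) *\<^sub>R a + (- y / 2) *\<^sub>R b" by (simp add: scaleR_add_right)
      then show False using indep by blast
    qed
    then have "dom ?\<gamma> \<kappa>" using dom_total[OF \<gamma>r \<kappa>(1,5)] by blast
    moreover have "\<kappa> \<noteq> ?\<gamma>" using \<open>\<not> dom \<kappa> ?\<gamma>\<close> by (auto simp: dom_def)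
    ultimately show ?thesis unfolding nonsmall_def using \<gamma>r \<gamma>C \<kappa>(1,2) by blast
  qed

  \<comment> \<open>The relation is irreflexive because \<open>d\<close>, hence every member of \<open>X\<close>, lies outside the plane of \<open>a\<close>
     and \<open>b\<close>.\<close>
  define below where "below x y \<longleftrightarrow>
    (\<exists>s p q. 0 < s \<and> 0 \<le> p \<and> 0 \<le> q \<and> 0 < p + q \<and> y = s *\<^sub>R x + p *\<^sub>R a + q *\<^sub>R b)" for x y
  define X where "X = {x \<in> roots. \<exists>s p q. 0 < s \<and> 0 \<le> p \<and> 0 \<le> q \<and> x = s *\<^sub>R d + p *\<^sub>R a + q *\<^sub>R b}"
  have belowI: "below x y" if "0 < s" "0 \<le> p" "0 \<le> q" "0 < p + q" "y = s *\<^sub>R x + p *\<^sub>R a + q *\<^sub>R b" for x y s p q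
    unfolding below_def using that by blast
  have below_X: "y \<in> X" if x: "x \<in> X" and xy: "below x y" and y: "y \<in> roots" for x y
  proof -
    obtain s p q where 1: "0 < s" "0 \<le> p" "0 \<le> q" "x = s *\<^sub>R d + p *\<^sub>R a + q *\<^sub>R b"
      using x by (auto simp: X_def)
    obtain s' p' q' where 2: "0 < s'" "0 \<le> p'" "0 \<le> q'" "y = s' *\<^sub>R x + p' *\<^sub>R a + q' *\<^sub>R b"
      using xy by (auto simp: below_def)
    have "y = (s' * s) *\<^sub>R d + (s' * p + p') *\<^sub>R a + (s' * q + q') *\<^sub>R b"
      unfolding 2(4) 1(4) by (simp add: algebra_simps)
    then show ?thesis unfolding X_def using 1 2 y
      by (intro CollectI conjI exI[of _ "s' * s"] exI[of _ "s' * p + p'"] exI[of _ "s' * q + q'"]) auto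
  qed
  have "below x z'" if xy: "below x y" and yz: "below y z'" for x y z'
  proof -
    obtain s p q where 1: "0 < s" "0 \<le> p" "0 \<le> q" "0 < p + q" "y = s *\<^sub>R x + p *\<^sub>R a + q *\<^sub>R b"
      using xy by (auto simp: below_def)
    obtain s' p' q' where 2: "0 < s'" "0 \<le> p'" "0 \<le> q'" "0 < p' + q'" "z' = s' *\<^sub>R y + p' *\<^sub>R a + q' *\<^sub>R b"
      using yz by (auto simp: below_def)
    have nn: "0 \<le> s' * p" "0 \<le> s' * q" using 1 2 by auto
    have pos: "0 < s' * s" "0 < s' * p + p' + (s' * q + q')" using 1(1) 2 nn by (simp, linarith)
    show ?thesis
    proof (rule belowI)
      show "z' = (s' * s) *\<^sub>R x + (s' * p + p') *\<^sub>R a + (s' * q + q') *\<^sub>R b"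
        unfolding 2(5) 1(5) by (simp add: algebra_simps)
    qed (use 2(2,3) nn pos in linarith)+
  qed
  then have trans: "transp_on X below" by (auto simp: transp_on_def)
  have irrefl: "\<not> below x x" if "x \<in> X" for x
  proof
    assume "below x x"
    then obtain s' p' q' where 2: "0 < s'" "0 \<le> p'" "0 \<le> q'" "0 < p' + q'" "x = s' *\<^sub>R x + p' *\<^sub>R a + q' *\<^sub>R b"
      by (auto simp: below_def)
    obtain s p q where 1: "0 < s" "x = s *\<^sub>R d + p *\<^sub>R a + q *\<^sub>R b"
      using \<open>x \<in> X\<close> by (auto simp: X_def)
    have s1: "s' = 1"
    proof (rule ccontr)
      assume "s' \<noteq> 1"
      have "((1 - s') * s) *\<^sub>R d = (p' - (1 - s') * p) *\<^sub>R a + (q' - (1 - s') * q) *\<^sub>R b"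
      proof -
        have "(1 - s') *\<^sub>R x = p' *\<^sub>R a + q' *\<^sub>R b" using 2(5) by (simp add: algebra_simps)
        then show ?thesis unfolding 1(2) by (simp add: algebra_simps)
      qed
      then have "(1 / ((1 - s') * s)) *\<^sub>R ((1 - s') * s) *\<^sub>R d =
        (1 / ((1 - s') * s)) *\<^sub>R ((p' - (1 - s') * p) *\<^sub>R a + (q' - (1 - s') * q) *\<^sub>R b)" by simp
      then have "d = (1 / ((1 - s') * s) * (p' - (1 - s') * p)) *\<^sub>R a + (1 / ((1 - s') * s) * (q' - (1 - s') * q)) *\<^sub>R b"
        using \<open>s' \<noteq> 1\<close> 1(1) by (simp add: scaleR_add_right)
      then show False using indep by blast
    qed
    then have 0: "p' *\<^sub>R a + q' *\<^sub>R b = 0" using 2(5) by (simp add: algebra_simps)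
    have "B (p' *\<^sub>R a + q' *\<^sub>R b) a = p' - q' * c" "B (p' *\<^sub>R a + q' *\<^sub>R b) b = q' - p' * c"
      using norm ab ba by (simp_all add: form_expand)
    then have "p' - q' * c + (q' - p' * c) = 0" unfolding 0 by (simp add: form_expand)
    moreover have "(p' + q') * (1 - c) = p' - q' * c + (q' - p' * c)" by (simp add: algebra_simps)
    ultimately have "(p' + q') * (1 - c) = 0" by simp
    then show False using 2(4) c(2) by simp
  qed
  have asymp: "asymp_on X below"
  proof (rule asymp_onI)
    fix x y assume "x \<in> X" "y \<in> X" "below x y"
    then show "\<not> below y x" using transp_onD[OF trans, of x y x] irrefl by blast
  qed
  have dX: "d \<in> X" unfolding X_def
    by (intro CollectI conjI exI[of _ 1] exI[of _ 0]) (simp_all add: d(1))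
  have "X \<subseteq> {r \<in> roots. r \<in> C \<and> - z r \<in> C}"
  proof
    fix x assume "x \<in> X"
    then obtain s p q where 1: "x \<in> roots" "0 < s" "0 \<le> p" "0 \<le> q" "x = s *\<^sub>R d + p *\<^sub>R a + q *\<^sub>R b"
      by (auto simp: X_def)
    have "x \<in> C" unfolding 1(5) using 1 a b d by (intro C_add C_scale) auto
    moreover have "- z x = s *\<^sub>R (- z d) + p *\<^sub>R a + q *\<^sub>R b" unfolding 1(5) by (simp add: lin z(2,3))
    moreover have "s *\<^sub>R (- z d) + p *\<^sub>R a + q *\<^sub>R b \<in> C" using 1 a b zd by (intro C_add C_scale) auto
    ultimately show "x \<in> {r \<in> roots. r \<in> C \<and> - z r \<in> C}" using 1(1) by simp
  qed
  then have "finite X" by (rule finite_subset) (rule finite_inversions[OF z(1)])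
  moreover have "X \<noteq> {}" using dX by blast
  ultimately obtain \<eta> where \<eta>X: "\<eta> \<in> X" and \<eta>max: "\<forall>x\<in>X. x \<noteq> \<eta> \<longrightarrow> \<not> below \<eta> x"
    using Finite_Set.bex_max_element[OF _ asymp trans] by meson
  have max: False if x: "x \<in> roots" "below \<eta> x" for x
  proof -
    have "x \<in> X" by (rule below_X[OF \<eta>X x(2,1)])
    moreover have "x \<noteq> \<eta>" using irrefl[OF \<eta>X] x(2) by auto
    ultimately show False using \<eta>max x(2) by simp
  qed
  obtain s p q where s: "0 < s" and pq: "0 \<le> p" "0 \<le> q" and \<eta>: "\<eta> \<in> roots" "\<eta> = s *\<^sub>R d + p *\<^sub>R a + q *\<^sub>R b"
    using \<eta>X by (auto simp: X_def)
  have \<eta>C: "\<eta> \<in> C" unfolding \<eta>(2) using s pq a b d by (intro C_add C_scale) auto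
  have sd: "s *\<^sub>R d = \<eta> - p *\<^sub>R a - q *\<^sub>R b" unfolding \<eta>(2) by simp
  define k1 k2 where "k1 = B a \<eta>" and "k2 = B b \<eta>"
  have k: "B a \<eta> = k1" "B \<eta> a = k1" "B b \<eta> = k2" "B \<eta> b = k2"
    using form_sym[of a \<eta>] form_sym[of b \<eta>] by (auto simp: k1_def k2_def)
  note forms = root_norm[OF \<eta>(1)] norm ab ba k

  have k_nonneg: "0 \<le> k1" "0 \<le> k2"
  proof -
    show "0 \<le> k1"
    proof (rule ccontr)
      assume "\<not> 0 \<le> k1"
      then have "below \<eta> (refl a \<eta>)" by (intro belowI[of 1 "- 2 * k1" 0]) (auto simp: refl_apply k)
      then show False using max refl_root[OF a(1) \<eta>(1)] by blast
    qed
    show "0 \<le> k2"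
    proof (rule ccontr)
      assume "\<not> 0 \<le> k2"
      then have "below \<eta> (refl b \<eta>)" by (intro belowI[of 1 0 "- 2 * k2"]) (auto simp: refl_apply k)
      then show False using max refl_root[OF b(1) \<eta>(1)] by blast
    qed
  qed
  have sq: "x\<^sup>2 < 1 / 4" if "0 < x" "x < 1 / 2" for x :: real
    using power_strict_mono[of x "1 / 2" 2] that by (simp add: power2_eq_square)
  \<comment> \<open>In the dihedral group of \<open>a\<close> and \<open>\<eta>\<close> let \<open>k1 = cos t\<close>, with \<open>a\<close> at angle \<open>0\<close> and \<open>\<eta>\<close> at angle \<open>t\<close>.
     For \<open>\<pi> / 3 < t < \<pi> / 2\<close> the root at angle \<open>3 t - \<pi>\<close>, and for \<open>\<pi> / 4 < t < \<pi> / 3\<close> the root at angle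
     \<open>4 t - \<pi>\<close>, lies strictly between \<open>a\<close> and \<open>\<eta>\<close>. Both contradict the choice of \<open>\<eta>\<close>.\<close>
  have k1_half: "\<not> (0 < k1 \<and> k1 < 1 / 2)"
  proof
    assume k1: "0 < k1 \<and> k1 < 1 / 2"
    have "below \<eta> (- chain a \<eta> 3)"
      using k1 sq[of k1] by (intro belowI[of "1 - 4 * k1\<^sup>2" "2 * k1" 0]) (auto simp: chain_3 k algebra_simps)
    then show False using max neg_root[OF chain_root[OF a(1) \<eta>(1)]] by blast
  qed
  have k2_half: "\<not> (0 < k2 \<and> k2 < 1 / 2)"
  proof
    assume k2: "0 < k2 \<and> k2 < 1 / 2"
    have "below \<eta> (- chain b \<eta> 3)"
      using k2 sq[of k2] by (intro belowI[of "1 - 4 * k2\<^sup>2" 0 "2 * k2"]) (auto simp: chain_3 k algebra_simps)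
    then show False using max neg_root[OF chain_root[OF b(1) \<eta>(1)]] by blast
  qed
  have k1_sqrt: "\<not> (1 / 2 < k1 \<and> 2 * k1\<^sup>2 < 1)"
  proof
    assume k1: "1 / 2 < k1 \<and> 2 * k1\<^sup>2 < 1"
    then have "1 / 4 < k1\<^sup>2" using power_strict_mono[of "1 / 2" k1 2] by (simp add: power2_eq_square)
    moreover have "0 < 4 * k1 * (1 - 2 * k1\<^sup>2)" using k1 by (intro mult_pos_pos) auto
    then have "0 < 4 * k1 - 8 * k1 ^ 3" by (simp add: power3_eq_cube power2_eq_square algebra_simps)
    ultimately have "below \<eta> (- chain a \<eta> 4)"
      by (intro belowI[of "4 * k1 - 8 * k1 ^ 3" "4 * k1\<^sup>2 - 1" 0]) (auto simp: chain_4 k algebra_simps)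
    then show False using max neg_root[OF chain_root[OF a(1) \<eta>(1)]] by blast
  qed

  \<comment> \<open>This is \<open>B(a, s d)\<^sup>2 \<ge> B(s d, s d)\<close>, in which \<open>p\<close> cancels.\<close>
  have quad: "1 - k1\<^sup>2 - 2 * q * (k2 + c * k1) + q\<^sup>2 * (1 - c\<^sup>2) \<le> 0"
  proof -
    have A: "s * B a d = k1 - p + q * c"
    proof -
      have "s * B a d = B a (s *\<^sub>R d)" by (simp add: form_expand)
      also have "\<dots> = k1 - p + q * c" unfolding sd by (simp add: form_expand forms)
      finally show ?thesis .
    qed
    have N: "s\<^sup>2 = 1 + p\<^sup>2 + q\<^sup>2 - 2 * p * k1 - 2 * q * k2 - 2 * c * p * q"
    proof -
      have "s\<^sup>2 = B (s *\<^sub>R d) (s *\<^sub>R d)" using root_norm[OF d(1)] by (simp add: form_expand power2_eq_square)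
      also have "\<dots> = 1 + p\<^sup>2 + q\<^sup>2 - 2 * p * k1 - 2 * q * k2 - 2 * c * p * q"
        unfolding sd by (simp add: form_expand forms power2_eq_square algebra_simps)
      finally show ?thesis .
    qed
    have "s \<le> s * B a d" using s dom_ad by simp
    then have "s\<^sup>2 \<le> (s * B a d)\<^sup>2" using s by (intro power_mono) auto
    then show ?thesis unfolding A N by (simp add: power2_eq_square algebra_simps)
  qed

  show ?thesis
  proof (cases "1 \<le> 2 * c * k1 + k2")
    case True
    then have "1 \<le> B ?\<gamma> \<eta>" unfolding \<gamma> by (simp add: form_expand forms)
    then show ?thesis by (rule candidate[OF \<eta>(1) \<eta>C \<eta>(2) s])
  next
    case False
    then have lt: "2 * c * k1 + k2 < 1" by simp
    have c_half: "1 / 2 < c"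
    proof (rule ccontr)
      assume "\<not> 1 / 2 < c"
      then have "c\<^sup>2 \<le> (1 / 2)\<^sup>2" using c by (intro power_mono) auto
      then show False using c(3) by (simp add: power2_eq_square)
    qed
    have "2 * k1\<^sup>2 < 1"
    proof -
      have "(2 * c * k1)\<^sup>2 < 1" using lt k_nonneg c by (simp add: abs_square_less_1)
      moreover have "1 * (2 * k1\<^sup>2) \<le> (2 * c\<^sup>2) * (2 * k1\<^sup>2)" using c by (intro mult_right_mono) auto
      ultimately show ?thesis by (simp add: power2_eq_square algebra_simps)
    qed
    then have "k1 = 0 \<or> k1 = 1 / 2" using k1_half k1_sqrt k_nonneg by linarith
    then show ?thesis
    proof
      \<comment> \<open>The reflection in \<open>\<eta>\<close> fixes \<open>a\<close>. If it kept \<open>b\<close> positive, then \<open>d\<close> would be negative; so the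
         negative of the image of \<open>b\<close> is a positive root, and \<open>\<gamma>\<close> dominates it.\<close>
      assume k1: "k1 = 0"
      have quad': "1 - 2 * q * k2 + q\<^sup>2 * (1 - c\<^sup>2) \<le> 0" using quad k1 by (simp add: algebra_simps)
      moreover have "0 \<le> q\<^sup>2 * (1 - c\<^sup>2)" using S1 by simp
      ultimately have qk2: "1 \<le> 2 * q * k2" by linarith
      then have k2_pos: "0 < k2" using k_nonneg(2) by (cases "k2 = 0") auto
      show ?thesis
      proof (cases "refl \<eta> b \<in> C")
        case True
        have "- (s *\<^sub>R d) = (2 * q * k2 - 1) *\<^sub>R \<eta> + p *\<^sub>R a + q *\<^sub>R refl \<eta> b"
          unfolding sd by (simp add: refl_apply k algebra_simps)
        also have "\<dots> \<in> C" using qk2 pq True a \<eta>C by (intro C_add C_scale) auto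
        finally have "s *\<^sub>R d = 0" by (rule C_pointed[OF C_scale[OF d(2) less_imp_le[OF s]]])
        then show ?thesis using s root_nonzero[OF d(1)] by simp
      next
        case False
        have r: "refl \<eta> b \<in> roots" by (rule refl_root[OF \<eta>(1) b(1)])
        have "0 \<le> ((1 - c\<^sup>2) * q - k2)\<^sup>2" by simp
        also have "\<dots> = (1 - c\<^sup>2) * (1 - 2 * q * k2 + q\<^sup>2 * (1 - c\<^sup>2)) + (k2\<^sup>2 - (1 - c\<^sup>2))"
          by (simp add: power2_eq_square algebra_simps)
        also have "\<dots> \<le> 0 + (k2\<^sup>2 - (1 - c\<^sup>2))"
          using quad' S1 by (intro add_right_mono mult_nonneg_nonpos) auto
        finally have k2c: "1 \<le> k2\<^sup>2 + c\<^sup>2" by simp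
        show ?thesis
        proof (rule candidate)
          show "- refl \<eta> b \<in> roots" by (rule neg_root[OF r])
          show "- refl \<eta> b \<in> C" using root_sign[OF r] False by simp
          show "- refl \<eta> b = (2 * k2 * s) *\<^sub>R d + (2 * k2 * p) *\<^sub>R a + (2 * k2 * q - 1) *\<^sub>R b"
            unfolding refl_apply k unfolding \<eta>(2) by (simp add: algebra_simps)
          show "0 < 2 * k2 * s" using k2_pos s by simp
          have "B ?\<gamma> (- refl \<eta> b) = 2 * (k2\<^sup>2 + c\<^sup>2) - 1"
            unfolding \<gamma> refl_apply using k1 by (simp add: form_expand forms power2_eq_square algebra_simps)
          then show "1 \<le> B ?\<gamma> (- refl \<eta> b)" using k2c by simp
        qed
      qed
    next
      \<comment> \<open>Now \<open>\<eta>\<close> is orthogonal to \<open>b\<close>, and \<open>\<eta> - a\<close> is a root whose form with \<open>b\<close> is \<open>c\<close>. The root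
         \<open>\<tau>\<close> below is the rotation of \<open>\<eta> - a\<close> by three times the angle between \<open>b\<close> and \<open>\<eta> - a\<close>. If it
         were negative, so would be \<open>d\<close>; so it is a positive root, and \<open>\<gamma>\<close> dominates it.\<close>
      assume k1: "k1 = 1 / 2"
      then have "2 * c * k1 = c" by simp
      then have k2: "k2 = 0" using lt c_half k_nonneg(2) k2_half by linarith
      have quad': "3 / 4 - q * c + q\<^sup>2 * (1 - c\<^sup>2) \<le> 0" using quad k1 k2 by (simp add: power2_eq_square)
      note c34 = half_angle_quadratic[OF c(1,2) pq(2) quad']
      have q0: "q \<noteq> 0" using quad' by auto
      \<comment> \<open>For \<open>p < 1\<close> the root \<open>- s\<^sub>\<eta> d\<close> would contradict the choice of \<open>\<eta>\<close>.\<close>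
      have p1: "1 \<le> p"
      proof (rule ccontr)
        assume p: "\<not> 1 \<le> p"
        have r: "- refl \<eta> d \<in> roots" using neg_root[OF refl_root[OF \<eta>(1) d(1)]] .
        have Bd: "B \<eta> (s *\<^sub>R d) = 1 - p / 2" unfolding sd by (simp add: form_expand forms k1 k2)
        have "s *\<^sub>R (- refl \<eta> d) = (1 - p) *\<^sub>R \<eta> + p *\<^sub>R a + q *\<^sub>R b"
        proof -
          have 1: "s *\<^sub>R (- refl \<eta> d) = (2 * B \<eta> (s *\<^sub>R d)) *\<^sub>R \<eta> - s *\<^sub>R d"
            by (simp add: refl_apply form_expand algebra_simps)
          show ?thesis unfolding 1 Bd unfolding sd by (simp add: algebra_simps scaleR_2)
        qed
        then have "(1 / s) *\<^sub>R s *\<^sub>R (- refl \<eta> d) = (1 / s) *\<^sub>R ((1 - p) *\<^sub>R \<eta> + p *\<^sub>R a + q *\<^sub>R b)" by simp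
        then have e: "- refl \<eta> d = ((1 - p) / s) *\<^sub>R \<eta> + (p / s) *\<^sub>R a + (q / s) *\<^sub>R b"
          using s by (simp add: scaleR_add_right)
        have "0 < p / s + q / s" using s pq q0 by (simp add: add_nonneg_pos)
        then have "below \<eta> (- refl \<eta> d)" using e p s pq by (intro belowI[of "(1 - p) / s" "p / s" "q / s"]) auto
        then show False using max r by blast
      qed
      define m where "m = 8 * c ^ 3 - 4 * c"
      have "0 < 4 * c * (2 * c\<^sup>2 - 1)" using c(1) c34(1) by (intro mult_pos_pos) auto
      then have m: "0 < m" unfolding m_def by (simp add: power3_eq_cube power2_eq_square algebra_simps)
      let ?\<kappa> = "refl a \<eta>"
      have \<kappa>: "?\<kappa> = \<eta> - a" by (simp add: refl_apply k k1)
      have \<kappa>r: "?\<kappa> \<in> roots" by (rule refl_root[OF a(1) \<eta>(1)])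
      have B\<kappa>: "B b ?\<kappa> = c" unfolding \<kappa> by (simp add: form_expand forms k2)
      let ?\<tau> = "chain b ?\<kappa> 4"
      have \<tau>: "?\<tau> = m *\<^sub>R (\<eta> - a) - (4 * c\<^sup>2 - 1) *\<^sub>R b" unfolding chain_4 B\<kappa> unfolding m_def \<kappa> by (rule HOL.refl)
      have \<tau>r: "?\<tau> \<in> roots" by (rule chain_root[OF b(1) \<kappa>r])
      show ?thesis
      proof (cases "?\<tau> \<in> C")
        case True
        show ?thesis
        proof (rule candidate[OF \<tau>r True])
          show "?\<tau> = (m * s) *\<^sub>R d + (m * p - m) *\<^sub>R a + (m * q - (4 * c\<^sup>2 - 1)) *\<^sub>R b"
            unfolding \<tau> unfolding \<eta>(2) by (simp add: algebra_simps)
          show "0 < m * s" using m s by simp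
          have "B ?\<gamma> ?\<tau> = (4 * c\<^sup>2 - 1) * (2 * c\<^sup>2 - 1)"
            unfolding \<tau> \<gamma> by (simp add: form_expand forms k1 k2 power2_eq_square algebra_simps)
          moreover have "2 * (1 / 2) \<le> (4 * c\<^sup>2 - 1) * (2 * c\<^sup>2 - 1)" using c34(1) by (intro mult_mono) auto
          ultimately show "1 \<le> B ?\<gamma> ?\<tau>" by simp
        qed
      next
        case False
        then have "- ?\<tau> \<in> C" using root_sign[OF \<tau>r] by blast
        have "0 \<le> (q * m - (4 * c\<^sup>2 - 1)) / m" using c34(2) m unfolding m_def[symmetric] by simp
        then have q1: "0 \<le> q - (4 * c\<^sup>2 - 1) / m" using m by (simp add: diff_divide_distrib)
        have "(1 / m) *\<^sub>R (- ?\<tau>) = a - \<eta> + ((4 * c\<^sup>2 - 1) / m) *\<^sub>R b"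
          unfolding \<tau> using m by (simp add: scaleR_diff_right)
        then have "- (s *\<^sub>R d) = (1 / m) *\<^sub>R (- ?\<tau>) + (p - 1) *\<^sub>R a + (q - (4 * c\<^sup>2 - 1) / m) *\<^sub>R b"
          unfolding sd by (simp add: algebra_simps)
        also have "\<dots> \<in> C" using m p1 q1 a b \<open>- ?\<tau> \<in> C\<close> by (intro C_add C_scale) auto
        finally have "s *\<^sub>R d = 0" by (rule C_pointed[OF C_scale[OF d(2) less_imp_le[OF s]]])
        then show ?thesis using s root_nonzero[OF d(1)] by simp
      qed
    qed
  qed
qed

section \<open>Planes that contain a small root in their interior\<close>

text \<open>
  The reflection of \<open>r\<close> shows that \<open>g\<close> lies strictly between the positive roots \<open>r\<close> and \<open>- s\<^sub>g r\<close>; as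
  \<open>g\<close> is small, both have form below \<open>1\<close> with \<open>g\<close>, and the plane is Euclidean. Choose an orthonormal
  basis \<open>a, e\<close> with \<open>B(g, e) > 0\<close>. The positive roots other than \<open>a\<close> are in the half plane of \<open>e\<close>, since
  \<open>x + s\<^sub>a x = 2 B(e, x) e\<close> is positive for each of them, in particular for \<open>g\<close>. The roots between \<open>g\<close>
  and \<open>r\<close> are inversions of \<open>s\<^sub>g\<close>, hence finite in number, and so the angles of the roots are the
  multiples of some \<open>\<pi> / m\<close>. The position \<open>m - 1\<close> is excluded for \<open>g\<close> because the reflection in that root
  keeps the other positive roots of the plane positive.
\<close>
lemma plane_polygon:
  assumes P: "subspace P" "dim P = 2"
    and a: "a \<in> P" "a \<in> roots" "a \<in> C"
    and extreme: "\<And>x. \<lbrakk>x \<in> P; x \<in> roots; x \<in> C; x \<noteq> a\<rbrakk> \<Longrightarrow> refl a x \<in> C"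
    and g: "g \<in> P" "g \<in> roots" "g \<in> C" and small: "\<not> nonsmall g"
    and r: "r \<in> P" "r \<in> roots" "r \<in> C" "r \<noteq> g" "refl g r \<notin> C"
  obtains e and m k :: int where
    "B e e = 1" "B a e = 0" "1 \<le> k" "k \<le> m - 2"
    "g = cos (of_int k * (pi / of_int m)) *\<^sub>R a + sin (of_int k * (pi / of_int m)) *\<^sub>R e"
    "\<And>j::int. cos (of_int j * (pi / of_int m)) *\<^sub>R a + sin (of_int j * (pi / of_int m)) *\<^sub>R e \<in> roots"
    "\<And>j::int. \<lbrakk>0 \<le> j; j < m\<rbrakk> \<Longrightarrow> cos (of_int j * (pi / of_int m)) *\<^sub>R a + sin (of_int j * (pi / of_int m)) *\<^sub>R e \<in> C"
proof -
  note norm = root_norm[OF a(2)] root_norm[OF g(2)] root_norm[OF r(2)]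
  have r': "- refl g r \<in> C" using root_sign[OF refl_root[OF g(2) r(2)]] r(5) by blast
  define \<beta> where "\<beta> = B g r"
  have rg: "B r g = \<beta>" using form_sym[of g r] by (simp add: \<beta>_def)
  have \<beta>_pos: "0 < \<beta>"
  proof (rule ccontr)
    assume "\<not> 0 < \<beta>"
    then have "- refl g r + (- 2 * \<beta>) *\<^sub>R g \<in> C" using r' g(3) by (intro C_add C_scale) auto
    moreover have "- refl g r + (- 2 * \<beta>) *\<^sub>R g = - r" by (simp add: refl_apply \<beta>_def)
    ultimately show False using root_not_both[OF r(2,3)] by simp
  qed
  have \<beta>_lt: "\<beta> < 1"
  proof (rule ccontr)
    assume "\<not> \<beta> < 1"
    then consider "dom g r" | "dom r g" using dom_total[OF g(2) r(2)] by (auto simp: \<beta>_def)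
    then show False
    proof cases
      case 1
      then show False using small g r by (auto simp: nonsmall_def)
    next
      case 2
      have "dom (refl g r) (refl g g)" by (rule dom_act[OF 2 refl_root_G[OF g(2)]])
      then have "dom (- refl g g) (- refl g r)"
        by (rule dom_neg[OF refl_root[OF g(2) r(2)] refl_root[OF g(2) g(2)]])
      then have "dom g (- refl g r)" using refl_self norm by simp
      moreover have "- refl g r \<noteq> g"
        using refl_refl[OF norm(2), of r] refl_refl[OF norm(2), of g] refl_self[OF norm(2)] r(4)
        by (metis minus_minus)
      ultimately show False
        using small g r' neg_root[OF refl_root[OF g(2) r(2)]] by (auto simp: nonsmall_def)
    qed
  qed
  have ag: "a \<noteq> g" using extreme[OF r(1-3)] r by auto
  have not_neg: "x \<noteq> - y" if "x \<in> C" "y \<in> roots" "y \<in> C" for x y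
    using root_not_both[OF that(2,3)] that(1) by auto
  have unit: "t = 1 \<or> t = - 1" if "x \<in> roots" "y \<in> roots" "x = t *\<^sub>R y" for x y t
    using root_norm[OF that(1)] root_norm[OF that(2)] power2_eq_1_iff[of t] unfolding that(3)
    by (simp add: form_expand power2_eq_square)
  define \<mu> where "\<mu> = B g a"
  have \<mu>: "B a g = \<mu>" using form_sym[of g a] by (simp add: \<mu>_def)
  have \<mu>_lt: "\<mu>\<^sup>2 < 1"
  proof -
    have "r \<noteq> t *\<^sub>R g" for t using unit[OF r(2) g(2), of t] r(4) not_neg[OF r(3) g(2,3)] by auto
    then obtain x y where xy: "a = x *\<^sub>R g + y *\<^sub>R r"
      using plane_spanned[OF P g(1) r(1) root_nonzero[OF g(2)] _ a(1)] by metis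
    have 1: "x\<^sup>2 + 2 * x * y * \<beta> + y\<^sup>2 = 1"
      using norm(1) norm(2,3) rg \<beta>_def[symmetric] unfolding xy
      by (simp add: form_expand power2_eq_square algebra_simps)
    have 2: "\<mu> = x + y * \<beta>" unfolding \<mu>_def xy using norm \<beta>_def by (simp add: form_expand)
    have "1 - \<mu>\<^sup>2 = y\<^sup>2 * (1 - \<beta>\<^sup>2)" unfolding 2 using 1 by (simp add: power2_eq_square algebra_simps)
    moreover have y0: "y \<noteq> 0"
    proof
      assume "y = 0"
      then have e: "a = x *\<^sub>R g" using xy by simp
      show False using unit[OF a(2) g(2) e] e ag not_neg[OF a(3) g(2,3)] by auto
    qed
    moreover have "0 < y\<^sup>2 * (1 - \<beta>\<^sup>2)"
      using y0 \<beta>_pos \<beta>_lt by (intro mult_pos_pos) (simp_all add: abs_square_less_1)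
    ultimately show ?thesis by linarith
  qed
  define n where "n = sqrt (1 - \<mu>\<^sup>2)"
  have n: "0 < n" "n\<^sup>2 = 1 - \<mu>\<^sup>2" using \<mu>_lt by (simp_all add: n_def)
  define e where "e = (1 / n) *\<^sub>R (g - \<mu> *\<^sub>R a)"
  have ge: "g = \<mu> *\<^sub>R a + n *\<^sub>R e" using n(1) by (simp add: e_def)
  have ae: "B a e = 0" unfolding e_def using norm \<mu> by (simp add: form_expand)
  have ea: "B e a = 0" using ae form_sym[of a e] by simp
  have ee: "B e e = 1"
  proof -
    have "B (g - \<mu> *\<^sub>R a) (g - \<mu> *\<^sub>R a) = n\<^sup>2"
      unfolding n(2) using norm \<mu> \<mu>_def by (simp add: form_expand power2_eq_square)
    moreover have "B e e = 1 / n\<^sup>2 * B (g - \<mu> *\<^sub>R a) (g - \<mu> *\<^sub>R a)"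
      unfolding e_def by (simp add: bilinear_lmul[OF form_bilinear] bilinear_rmul[OF form_bilinear] power2_eq_square)
    ultimately show ?thesis using n(1) by simp
  qed
  have eP: "e \<in> P" unfolding e_def using P(1) a(1) g(1)
    by (intro subspace_scale subspace_diff) auto
  note forms = norm(1) ae ea ee
  have coords: "v = B a v *\<^sub>R a + B e v *\<^sub>R e" if v: "v \<in> P" for v
  proof -
    have "e \<noteq> t *\<^sub>R a" for t
    proof
      assume "e = t *\<^sub>R a"
      then have "e = 0" using ae norm(1) by (simp add: form_expand)
      then show False using ee by (simp add: form_expand)
    qed
    then obtain x y where "v = x *\<^sub>R a + y *\<^sub>R e"
      using plane_spanned[OF P a(1) eP root_nonzero[OF a(2)] _ v] by metis
    then show ?thesis by (simp add: form_expand forms)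
  qed
  have refl_a: "refl a x = - B a x *\<^sub>R a + B e x *\<^sub>R e" if "x \<in> P" for x
  proof -
    have "x - (2 * B a x) *\<^sub>R a = B a x *\<^sub>R a + B e x *\<^sub>R e - (2 * B a x) *\<^sub>R a"
      by (subst coords[OF that]) (rule HOL.refl)
    then show ?thesis unfolding refl_apply by (simp add: algebra_simps scaleR_twice)
  qed
  have doubled: "(2 * B e x) *\<^sub>R e \<in> C" if x: "x \<in> P" "x \<in> roots" "x \<in> C" "x \<noteq> a" for x
  proof -
    have "x + refl a x = (2 * B e x) *\<^sub>R e"
      unfolding refl_a[OF x(1)] by (subst coords[OF x(1)]) (simp add: algebra_simps scaleR_twice)
    then show ?thesis using C_add[OF x(3) extreme[OF x]] by simp
  qed
  have "B e g = n" unfolding ge by (simp add: form_expand forms)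
  then have "(2 * n) *\<^sub>R e \<in> C" using doubled[OF g ag[symmetric]] by simp
  from C_scale[OF this, of "1 / (2 * n)"] have eC: "e \<in> C" using n(1) by simp
  have above: "0 < B e x" if x: "x \<in> P" "x \<in> roots" "x \<in> C" "x \<noteq> a" for x
  proof (rule ccontr)
    assume "\<not> 0 < B e x"
    then consider "B e x = 0" | "B e x < 0" by linarith
    then show False
    proof cases
      case 1
      then have e: "x = B a x *\<^sub>R a" using coords[OF x(1)] by simp
      show False
        using unit[OF x(2) a(2) e]
      proof
        assume "B a x = 1" then show False using e x(4) by simp
      next
        assume "B a x = - 1" then show False using e not_neg[OF x(3) a(2,3)] by simp
      qed
    next
      case 2
      from C_scale[OF doubled[OF x], of "1 / (- 2 * B e x)"] 2 have "- e \<in> C" by simp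
      then have "e = 0" by (rule C_pointed[OF eC])
      then show False using ee by (simp add: form_expand)
    qed
  qed

  define E where "E t = cos t *\<^sub>R a + sin t *\<^sub>R e" for t
  have EP: "E t \<in> P" for t unfolding E_def using P(1) a(1) eP by (intro subspace_add subspace_scale)
  have B_E: "B (E s) (E t) = cos (s - t)" for s t
    unfolding E_def by (simp add: form_expand forms cos_diff)
  have E_refl: "- refl (E s) (E t) = E (2 * s - t)" for s t
  proof -
    have "2 * cos (s - t) * cos s - cos t = cos (2 * s - t)" "2 * cos (s - t) * sin s - sin t = sin (2 * s - t)"
    proof -
      define u where "u = s - t"
      have t: "t = s - u" "2 * s - t = s + u" by (auto simp: u_def)
      show "2 * cos (s - t) * cos s - cos t = cos (2 * s - t)" "2 * cos (s - t) * sin s - sin t = sin (2 * s - t)"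
        unfolding t(2) unfolding t(1) by (simp_all add: cos_add sin_add cos_diff sin_diff)
    qed
    then have "E (2 * s - t) = (2 * cos (s - t)) *\<^sub>R E s - E t"
      unfolding E_def by (simp add: algebra_simps)
    then show ?thesis unfolding refl_apply B_E by simp
  qed
  have E_pi: "E (t + pi) = - E t" for t by (simp add: E_def)
  have E_ex: "\<exists>t. 0 \<le> t \<and> t < pi \<and> x = E t" if x: "x \<in> P" "x \<in> roots" "x \<in> C" for x
  proof -
    have "(B a x)\<^sup>2 + (B e x)\<^sup>2 = 1"
    proof -
      have "B x x = (B a x)\<^sup>2 + (B e x)\<^sup>2"
        by (subst (1 2) coords[OF x(1)]) (simp add: form_expand forms power2_eq_square)
      then show ?thesis using root_norm[OF x(2)] by simp
    qed
    then obtain t where t: "0 \<le> t" "t < 2 * pi" "B a x = cos t" "B e x = sin t" by (rule sincos_total_2pi)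
    then have xE: "x = E t" using coords[OF x(1)] by (simp add: E_def)
    have "t < pi"
    proof (cases "x = a")
      case True
      then have "cos t = 1" using t(3) norm(1) by simp
      show ?thesis
      proof (rule ccontr)
        assume "\<not> t < pi"
        then have "cos (2 * pi - t) < 1" using t(2) cos_monotone_0_pi[of 0 "2 * pi - t"] by simp
        then show False using \<open>cos t = 1\<close> by simp
      qed
    next
      case False
      then have "0 < sin t" using above[OF x] t(4) by simp
      then show ?thesis using t(2) sin_le_zero[of t] by (meson not_le)
    qed
    then show ?thesis using xE t(1) by blast
  qed
  define \<Theta> where "\<Theta> = {t. E t \<in> roots}"
  have \<Theta>_zero: "0 \<in> \<Theta>" using a(2) by (simp add: \<Theta>_def E_def)
  have \<Theta>_pi: "pi \<in> \<Theta>" using neg_root[OF a(2)] by (simp add: \<Theta>_def E_def)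
  have \<Theta>_closed: "2 * s - t \<in> \<Theta>" if "s \<in> \<Theta>" "t \<in> \<Theta>" for s t
    using that neg_root[OF refl_root, of "E s" "E t"] unfolding \<Theta>_def E_refl by simp
  obtain tg where tg: "0 \<le> tg" "tg < pi" "g = E tg" using E_ex[OF g] by blast
  obtain tr where tr: "0 \<le> tr" "tr < pi" "r = E tr" using E_ex[OF r(1-3)] by blast
  let ?lo = "min tg tr" and ?hi = "max tg tr"
  have lohi: "?lo < ?hi" using r(4) tg(3) tr(3) by (cases "tg = tr") auto
  let ?N = "{x \<in> roots. x \<in> C \<and> - refl g x \<in> C}"
  have inv: "E ` (\<Theta> \<inter> {?lo..?hi}) \<subseteq> ?N"
  proof
    fix x assume "x \<in> E ` (\<Theta> \<inter> {?lo..?hi})"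
    then obtain t where t: "x = E t" "E t \<in> roots" "?lo \<le> t" "t \<le> ?hi" by (auto simp: \<Theta>_def)
    define D where "D = sin (?hi - ?lo)"
    have D: "0 < D" unfolding D_def using lohi tg tr by (intro sin_gt_zero) auto
    have comb: "D *\<^sub>R E t = sin (?hi - t) *\<^sub>R E ?lo + sin (t - ?lo) *\<^sub>R E ?hi"
    proof -
      have "D * cos t = sin (?hi - t) * cos ?lo + sin (t - ?lo) * cos ?hi"
        "D * sin t = sin (?hi - t) * sin ?lo + sin (t - ?lo) * sin ?hi"
      proof -
        have "sin (hi - lo) * cos t = sin (hi - t) * cos lo + sin (t - lo) * cos hi"
          "sin (hi - lo) * sin t = sin (hi - t) * sin lo + sin (t - lo) * sin hi" for hi lo :: real
          by (simp_all add: sin_diff algebra_simps)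
        then show "D * cos t = sin (?hi - t) * cos ?lo + sin (t - ?lo) * cos ?hi"
          "D * sin t = sin (?hi - t) * sin ?lo + sin (t - ?lo) * sin ?hi" unfolding D_def by blast+
      qed
      then show ?thesis unfolding E_def by (simp add: algebra_simps)
    qed
    have nn: "0 \<le> sin (?hi - t)" "0 \<le> sin (t - ?lo)" using t tg tr by (auto intro!: sin_ge_zero)
    have lin: "linear (refl g)" by (rule linear_refl)
    have ends: "E ?lo \<in> {g, r}" "E ?hi \<in> {g, r}" using tg(3) tr(3) by (auto simp: min_def max_def)
    then have endsC: "E ?lo \<in> C" "E ?hi \<in> C" using g(3) r(3) by auto
    have "- refl g g \<in> C" using g(3) refl_self[OF norm(2)] by simp
    then have endsN: "- refl g (E ?lo) \<in> C" "- refl g (E ?hi) \<in> C" using ends r' by auto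
    have "D *\<^sub>R E t \<in> C" unfolding comb by (rule C_combine[OF endsC nn])
    from C_scale[OF this, of "1 / D"] have "E t \<in> C" using D by simp
    moreover have "- refl g (D *\<^sub>R E t) = sin (?hi - t) *\<^sub>R (- refl g (E ?lo)) + sin (t - ?lo) *\<^sub>R (- refl g (E ?hi))"
      unfolding comb linear_add[OF lin] linear_cmul[OF lin] by simp
    then have "- refl g (D *\<^sub>R E t) \<in> C" using C_combine[OF endsN nn] by simp
    then have "D *\<^sub>R (- refl g (E t)) \<in> C" by (simp add: linear_cmul[OF lin])
    from C_scale[OF this, of "1 / D"] have "- refl g (E t) \<in> C" using D by simp
    ultimately show "x \<in> ?N" using t by simp
  qed
  have injE: "inj_on E (\<Theta> \<inter> {?lo..?hi})"
  proof (rule inj_onI)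
    fix s t assume s: "s \<in> \<Theta> \<inter> {?lo..?hi}" and t: "t \<in> \<Theta> \<inter> {?lo..?hi}" and eq: "E s = E t"
    have "B a (E u) = cos u" for u unfolding E_def by (simp add: form_expand forms)
    then have "cos s = cos t" using eq by metis
    moreover have "0 \<le> s" "s \<le> pi" "0 \<le> t" "t \<le> pi" using s t tg tr by auto
    ultimately show "s = t" using cos_inj_pi by blast
  qed
  have "finite (E ` (\<Theta> \<inter> {?lo..?hi}))"
    by (rule finite_subset[OF inv finite_inversions[OF refl_root_G[OF g(2)]]])
  then have "finite (\<Theta> \<inter> {?lo..?hi})" using injE by (rule finite_imageD)
  then obtain m :: int where m: "0 < m" "\<Theta> = {of_int k * (pi / of_int m) |k::int. True}"
    using reflection_closed_discrete[OF \<Theta>_zero \<Theta>_pi \<Theta>_closed lohi] by blast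
  define \<theta> where "\<theta> = pi / of_int m"
  have m\<theta>: "of_int m * \<theta> = pi" using m(1) by (simp add: \<theta>_def)
  have \<theta>_pos: "0 < \<theta>" using m(1) by (simp add: \<theta>_def)
  have E_root: "E (of_int j * \<theta>) \<in> roots" for j :: int
  proof -
    have "of_int j * \<theta> \<in> \<Theta>" unfolding m(2) \<theta>_def by blast
    then show ?thesis by (simp add: \<Theta>_def)
  qed
  have E_pos: "E (of_int j * \<theta>) \<in> C" if j: "0 \<le> j" "j < m" for j :: int
  proof (cases "j = 0")
    case True
    then show ?thesis using a(3) by (simp add: E_def)
  next
    case False
    then have "0 < of_int j * \<theta>" using j \<theta>_pos by simp
    moreover have "of_int j * \<theta> < pi" unfolding m\<theta>[symmetric] using j \<theta>_pos by simp
    ultimately have s: "0 < sin (of_int j * \<theta>)" by (rule sin_gt_zero)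
    show ?thesis
    proof (rule ccontr)
      assume "\<not> ?thesis"
      then have nC: "- E (of_int j * \<theta>) \<in> C" using root_sign[OF E_root] by blast
      have Be: "B e (- E (of_int j * \<theta>)) = - sin (of_int j * \<theta>)" unfolding E_def by (simp add: form_expand forms)
      then have "- E (of_int j * \<theta>) \<noteq> a" using ea s by auto
      then have "0 < B e (- E (of_int j * \<theta>))"
        using above[OF subspace_neg[OF P(1) EP] neg_root[OF E_root] nC] by blast
      then show False using Be s by simp
    qed
  qed
  have index: "\<exists>k. 0 \<le> k \<and> k < m \<and> x = E (of_int k * \<theta>)" if x: "x \<in> P" "x \<in> roots" "x \<in> C" for x
  proof -
    obtain t where t: "0 \<le> t" "t < pi" "x = E t" using E_ex[OF x] by blast
    then have "t \<in> \<Theta>" using x(2) by (simp add: \<Theta>_def)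
    then obtain k :: int where k: "t = of_int k * \<theta>" unfolding m(2) \<theta>_def by blast
    have "0 \<le> k" using t(1) k \<theta>_pos by (simp add: zero_le_mult_iff)
    moreover have "k < m" using t(2) k \<theta>_pos unfolding m\<theta>[symmetric] by simp
    ultimately show ?thesis using t(3) k by blast
  qed
  obtain k where k: "0 \<le> k" "k < m" "g = E (of_int k * \<theta>)" using index[OF g] by blast
  obtain j where j: "0 \<le> j" "j < m" "r = E (of_int j * \<theta>)" using index[OF r(1-3)] by blast
  have "k \<noteq> 0"
  proof
    assume "k = 0"
    then show False using k(3) ag by (simp add: E_def)
  qed
  moreover have "k \<noteq> m - 1"
  proof
    assume km: "k = m - 1"
    then have "j \<noteq> m - 1" using r(4) j k by auto
    have "refl g r = - E (2 * (of_int k * \<theta>) - of_int j * \<theta>)" unfolding k(3) j(3) E_refl[symmetric] by simp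
    also have "2 * (of_int k * \<theta>) - of_int j * \<theta> = of_int (m - 2 - j) * \<theta> + pi"
      unfolding m\<theta>[symmetric] km by (simp add: algebra_simps)
    finally have "refl g r = E (of_int (m - 2 - j) * \<theta>)" unfolding E_pi by simp
    then show False using E_pos[of "m - 2 - j"] r(5) j \<open>j \<noteq> m - 1\<close> by simp
  qed
  ultimately have k2: "1 \<le> k" "k \<le> m - 2" using k(1,2) by linarith+
  show thesis
    by (rule that[OF ee ae k2 k(3)[unfolded E_def \<theta>_def] E_root[unfolded E_def \<theta>_def] E_pos[unfolded E_def \<theta>_def]])
qed

text \<open>
  If \<open>2 l = i + j + m\<close>, then the root at position \<open>l\<close> reflects position \<open>i\<close> to position \<open>j\<close>, and for
  \<open>0 \<le> i \<le> j \<le> m - 2 - i\<close> it is positive and has nonpositive form with the root at position \<open>i\<close>. The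
  proof starts from \<open>i = 0\<close> and, for the other parity, from \<open>i = 1\<close>.
\<close>
theorem plane_nonsmall:
  assumes P: "subspace P" "dim P = 2"
    and a: "a \<in> P" "a \<in> roots" "a \<in> C"
    and extreme: "\<And>x. \<lbrakk>x \<in> P; x \<in> roots; x \<in> C; x \<noteq> a\<rbrakk> \<Longrightarrow> refl a x \<in> C"
    and g: "g \<in> P" "g \<in> roots" "g \<in> C"
    and r: "r \<in> P" "r \<in> roots" "r \<in> C" "r \<noteq> g" "refl g r \<notin> C"
    and ns: "nonsmall a"
  shows "nonsmall g"
proof (rule ccontr)
  assume small: "\<not> nonsmall g"
  obtain e and m k :: int where e: "B e e = 1" "B a e = 0" and k: "1 \<le> k" "k \<le> m - 2"
    and g_eq: "g = cos (of_int k * (pi / of_int m)) *\<^sub>R a + sin (of_int k * (pi / of_int m)) *\<^sub>R e"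
    and E_root': "\<And>j::int. cos (of_int j * (pi / of_int m)) *\<^sub>R a + sin (of_int j * (pi / of_int m)) *\<^sub>R e \<in> roots"
    and E_pos': "\<And>j::int. \<lbrakk>0 \<le> j; j < m\<rbrakk> \<Longrightarrow>
      cos (of_int j * (pi / of_int m)) *\<^sub>R a + sin (of_int j * (pi / of_int m)) *\<^sub>R e \<in> C"
    by (rule plane_polygon[OF P a extreme g small r]; (assumption | (rule that; assumption)))
  define \<theta> where "\<theta> = pi / of_int m"
  define E where "E j = cos (of_int j * \<theta>) *\<^sub>R a + sin (of_int j * \<theta>) *\<^sub>R e" for j :: int
  have gE: "g = E k" using g_eq by (simp add: E_def \<theta>_def)
  have E_root: "E j \<in> roots" for j using E_root'[of j] by (simp add: E_def \<theta>_def)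
  have E_pos: "E j \<in> C" if "0 \<le> j" "j < m" for j using E_pos'[OF that] by (simp add: E_def \<theta>_def)
  have m\<theta>: "of_int m * \<theta> = pi" using k by (simp add: \<theta>_def)
  have \<theta>_pos: "0 < \<theta>" using k by (simp add: \<theta>_def)
  have E0: "E 0 = a" by (simp add: E_def)
  note forms = root_norm[OF a(2)] e(1) e(2) e(2)[unfolded form_sym[of a e]]
  have B_E: "B (E i) (E j) = cos (of_int (i - j) * \<theta>)" for i j
    unfolding E_def by (simp add: form_expand forms cos_diff left_diff_distrib)
  have E_refl: "refl (E i) (E j) = E (2 * i - j + m)" for i j
  proof -
    define s t where "s = of_int i * \<theta>" and "t = of_int j * \<theta>"
    have u: "of_int (2 * i - j + m) * \<theta> = (2 * s - t) + pi"
      unfolding s_def t_def m\<theta>[symmetric] by (simp add: algebra_simps)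
    have "cos t - 2 * cos (s - t) * cos s = - cos (2 * s - t)" "sin t - 2 * cos (s - t) * sin s = - sin (2 * s - t)"
    proof -
      define w where "w = s - t"
      have t: "t = s - w" "2 * s - t = s + w" by (auto simp: w_def)
      show "cos t - 2 * cos (s - t) * cos s = - cos (2 * s - t)" "sin t - 2 * cos (s - t) * sin s = - sin (2 * s - t)"
        unfolding t(2) unfolding t(1) by (simp_all add: cos_add sin_add cos_diff sin_diff)
    qed
    moreover have "E j - (2 * cos (s - t)) *\<^sub>R E i =
      (cos t - 2 * cos (s - t) * cos s) *\<^sub>R a + (sin t - 2 * cos (s - t) * sin s) *\<^sub>R e"
      unfolding E_def s_def[symmetric] t_def[symmetric] by (simp add: algebra_simps)
    moreover have "E (2 * i - j + m) = - cos (2 * s - t) *\<^sub>R a + - sin (2 * s - t) *\<^sub>R e"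
      unfolding E_def u by simp
    moreover have "of_int (i - j) * \<theta> = s - t" by (simp add: s_def t_def left_diff_distrib)
    ultimately show ?thesis unfolding refl_apply B_E by simp
  qed
  have E_period: "E (j + 2 * m) = E j" for j
  proof -
    have "of_int (j + 2 * m) * \<theta> = of_int j * \<theta> + 2 * pi" unfolding m\<theta>[symmetric] by (simp add: algebra_simps)
    then show ?thesis unfolding E_def by simp
  qed
  have step: "nonsmall (E j)" if ns: "nonsmall (E i)" and i: "0 \<le> i" and j: "i \<le> j" "i + j + m = 2 * l" "l < m" for i j l
  proof -
    have l: "i \<le> l" "0 \<le> l" using j i by linarith+
    define x where "x = of_int (i - l) * \<theta>"
    have eqs: "of_int (2 * (i - l)) * \<theta> = 2 * x" "of_int (- m) * \<theta> = - pi"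
      unfolding x_def using m\<theta> by (simp_all add: algebra_simps)
    have il: "2 * (i - l) = i - j - m" unfolding right_diff_distrib j(2)[symmetric] by simp
    have "2 * (i - l) \<le> - m" unfolding il using j(1) by simp
    then have "real_of_int (2 * (i - l)) \<le> of_int (- m)" by (simp only: of_int_le_iff)
    from mult_right_mono[OF this less_imp_le[OF \<theta>_pos]] have up: "2 * x \<le> - pi" unfolding eqs .
    have "- m \<le> i - l" using j(3) i by simp
    then have "real_of_int (- m) \<le> of_int (i - l)" by (simp only: of_int_le_iff)
    from mult_right_mono[OF this less_imp_le[OF \<theta>_pos]] have "- pi \<le> x"
      unfolding eqs x_def[symmetric] .
    with up have "0 \<le> cos (x + pi)" by (intro cos_ge_zero) linarith+
    then have "cos (of_int (i - l) * \<theta>) \<le> 0" unfolding x_def[symmetric] by simp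
    then have "B (E i) (E l) \<le> 0" unfolding B_E by simp
    then have "nonsmall (refl (E l) (E i))" by (rule nonsmall_refl[OF ns E_root E_pos[OF l(2) j(3)]])
    also have "refl (E l) (E i) = E (j + 2 * m)" unfolding E_refl using j(2) by (intro arg_cong[of _ _ E]) linarith
    finally show ?thesis unfolding E_period .
  qed
  have same: "nonsmall (E j)" if j: "0 \<le> j" "j \<le> m - 2" "even (j + m)" for j
  proof -
    obtain l where l: "j + m = 2 * l" using j(3) by (elim evenE)
    show ?thesis
    proof (rule step[of 0 j l])
      show "nonsmall (E 0)" using ns E0 by simp
      show "0 + j + m = 2 * l" using l by simp
      show "l < m" using l j(2) by simp
    qed (use j(1) in simp_all)
  qed
  have "nonsmall (E k)"
  proof (cases "even (k + m)")
    case True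
    then show ?thesis using same k by simp
  next
    case False
    have one: "nonsmall (E 1)"
    proof (cases "even m")
      case False
      then show ?thesis using same[of 1] k by simp
    next
      case True
      then obtain h where h: "m = 2 * h" by (elim evenE)
      have m4: "4 \<le> m" using k h by presburger
      have "of_int 4 * \<theta> \<le> of_int m * \<theta>" using m4 \<theta>_pos by (intro mult_right_mono) auto
      then have \<theta>_le: "\<theta> \<le> pi / 4" using m\<theta> by simp
      let ?b = "E (m - 1)"
      have ab: "B a ?b = - cos \<theta>"
      proof -
        have "of_int (0 - (m - 1)) * \<theta> = \<theta> - pi" using m\<theta> by (simp add: algebra_simps)
        then show ?thesis using B_E[of 0 "m - 1"] unfolding E0 by simp
      qed
      have c: "0 < cos \<theta>" "cos \<theta> < 1" "1 \<le> 2 * (cos \<theta>)\<^sup>2"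
      proof -
        show "0 < cos \<theta>" using \<theta>_pos \<theta>_le by (intro cos_gt_zero_pi) linarith+
        show "cos \<theta> < 1" using cos_monotone_0_pi[of 0 \<theta>] \<theta>_pos \<theta>_le by simp
        have "0 \<le> cos (2 * \<theta>)" using \<theta>_pos \<theta>_le by (intro cos_ge_zero) linarith+
        then show "1 \<le> 2 * (cos \<theta>)\<^sup>2" by (simp add: cos_double_cos)
      qed
      \<comment> \<open>Since \<open>m\<close> is even, \<open>e\<close> is a root, and \<open>s\<^sub>a s\<^sub>e\<close> is \<open>- 1\<close> on the plane.\<close>
      have eE: "e = E h"
      proof -
        have half: "of_int h * \<theta> = pi / 2" using m\<theta> h by simp
        show ?thesis unfolding E_def half by simp
      qed
      have er: "e \<in> roots" using E_root[of h] eE by simp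
      let ?z = "refl a \<circ> refl e"
      have z: "?z v = v - (2 * B a v) *\<^sub>R a - (2 * B e v) *\<^sub>R e" for v
        by (simp add: refl_apply form_expand forms)
      have z_plane: "?z (x *\<^sub>R a + y *\<^sub>R e) = - (x *\<^sub>R a + y *\<^sub>R e)" for x y
        unfolding z by (simp add: form_expand forms algebra_simps scaleR_twice)
      have sin: "sin (of_int (m - 1) * \<theta>) \<noteq> 0"
      proof -
        have "of_int (m - 1) * \<theta> = pi - \<theta>" using m\<theta> by (simp add: algebra_simps)
        moreover have "0 < sin \<theta>" using \<theta>_pos \<theta>_le by (intro sin_gt_zero) linarith+
        ultimately show ?thesis by simp
      qed
      have "nonsmall (refl a ?b)"
      proof (rule neighbour_nonsmall[OF a(2,3) E_root E_pos ab c])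
        show "?z \<in> G" by (intro comp_G refl_root_G a(2) er)
        show "?z a = - a" using z_plane[of 1 0] by simp
        show "?z ?b = - ?b" unfolding E_def by (rule z_plane)
        show "\<exists>x y. ?z v - v = x *\<^sub>R a + y *\<^sub>R ?b" for v
        proof -
          let ?C = "cos (of_int (m - 1) * \<theta>)" and ?S = "sin (of_int (m - 1) * \<theta>)"
          have "e = (1 / ?S) *\<^sub>R ?b - (?C / ?S) *\<^sub>R a" unfolding E_def using sin by (simp add: scaleR_add_right)
          then have "(2 * B e v) *\<^sub>R e = (2 * B e v) *\<^sub>R ((1 / ?S) *\<^sub>R ?b - (?C / ?S) *\<^sub>R a)" by simp
          then have "?z v - v = (- 2 * B a v + 2 * B e v * (?C / ?S)) *\<^sub>R a + (- 2 * B e v * (1 / ?S)) *\<^sub>R ?b"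
            unfolding z by (simp add: algebra_simps)
          then show ?thesis by blast
        qed
      qed (use m4 ns in auto)
      also have "refl a ?b = E (1 + 2 * 0)"
        using E_refl[of 0 "m - 1"] unfolding E0 by simp
      finally show ?thesis by simp
    qed
    have "even (1 + k + m)" using False by simp
    then obtain l where l: "1 + k + m = 2 * l" by (elim evenE)
    have "k \<noteq> m - 2" using False by auto
    then have "k \<le> m - 3" using k(2) by simp
    show ?thesis
    proof (rule step[OF one])
      show "1 + k + m = 2 * l" by (rule l)
      show "l < m" using l \<open>k \<le> m - 3\<close> by simp
    qed (use k(1) in simp_all)
  qed
  then show False using small gE by simp
qed

end

section \<open>Small roots of a Coxeter system\<close>

context geometric_representation
begin

lemma rep_mult: "\<lbrakk>x \<in> carrier W; y \<in> carrier W\<rbrakk> \<Longrightarrow> \<rho> (x \<otimes> y) = \<rho> x \<circ> \<rho> y"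
  using hom_mult[OF rep_hom] by (simp add: isometry_group_def)

lemma rep_one: "\<rho> \<one> = id"
proof -
  have "bij (\<rho> \<one>)" using hom_in_carrier[OF rep_hom, of \<one>] by (simp add: isometry_group_def)
  then have "\<rho> \<one> (\<rho> \<one> v) = \<rho> \<one> v \<Longrightarrow> \<rho> \<one> v = v" for v by (simp add: bij_def inj_eq)
  then show ?thesis using rep_mult[of \<one> \<one>] by (auto simp: fun_eq_iff)
qed

lemma rep_inv:
  assumes "w \<in> carrier W" shows "\<rho> (inv w) (\<rho> w v) = v" "\<rho> w (\<rho> (inv w) v) = v"
  using rep_mult[of "inv w" w] rep_mult[of w "inv w"] rep_one assms by (auto simp: fun_eq_iff)

text \<open>
  The image of \<open>W\<close> under \<open>\<rho>\<close> is the group generated by the simple reflections, so that the results on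
  root bases apply with \<open>\<rho> (inv w)\<close> in the place of \<open>g\<close>.
\<close>
interpretation rb: root_basis B simple_roots
proof
  show "bilinear B" by (rule B_bilinear)
  show "B x y = B y x" for x y by (rule B_sym)
  show "finite simple_roots" using finite_S by (simp add: simple_roots_def)
  show "\<forall>a\<in>simple_roots. c a = 0"
    if c: "\<forall>a\<in>simple_roots. 0 \<le> c a" "(\<Sum>a\<in>simple_roots. c a *\<^sub>R a) = 0" for c
  proof -
    have "(\<Sum>s\<in>S. c (\<alpha> s) *\<^sub>R \<alpha> s) = 0"
      using c(2) unfolding simple_roots_def sum.reindex[OF simple_inj] by simp
    moreover have "\<forall>s\<in>S. 0 \<le> c (\<alpha> s)" using c(1) by (simp add: simple_roots_def)
    ultimately have "\<forall>s\<in>S. c (\<alpha> s) = 0" by (rule simple_pos_indep[rotated])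
    then show ?thesis by (simp add: simple_roots_def)
  qed
  show "B a b \<in> {..- 1} \<union> {- cos (pi / real k) |k::nat. 2 \<le> k}"
    if ab: "a \<in> simple_roots" "b \<in> simple_roots" "a \<noteq> b" for a b
  proof -
    obtain s t where "a = \<alpha> s" "b = \<alpha> t" "s \<in> S" "t \<in> S" "s \<noteq> t" using ab by (auto simp: simple_roots_def)
    then show ?thesis using simple_form[of s t] by simp
  qed
  show "B a a = 1" if "a \<in> simple_roots" for a using that simple_norm by (auto simp: simple_roots_def)
qed

lemma G_eq: "rb.G = \<rho> ` carrier W"
proof (rule equalityI; rule subsetI)
  fix g assume "g \<in> rb.G"
  then obtain u where u: "u \<in> lists simple_roots" "g = rb.act u" by (auto simp: rb.G_def)
  have "rb.act u \<in> \<rho> ` carrier W" using u(1)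
  proof (induction u)
    case Nil
    then show ?case using rep_one by (auto intro!: image_eqI[of _ _ \<one>])
  next
    case (Cons a u)
    then obtain s w where s: "s \<in> S" "a = \<alpha> s" and w: "w \<in> carrier W" "rb.act u = \<rho> w"
      by (auto simp: simple_roots_def)
    have sW: "s \<in> carrier W" using s(1) generators_closed by blast
    have "rb.act (a # u) = \<rho> (s \<otimes> w)" unfolding rep_mult[OF sW w(1)] by (simp add: s w rep_simple)
    then show ?case using sW w(1) by blast
  qed
  then show "g \<in> \<rho> ` carrier W" using u(2) by simp
next
  fix g assume "g \<in> \<rho> ` carrier W"
  then obtain w where w: "w \<in> generate W S" "g = \<rho> w" using generators_generate by auto
  have simple: "\<rho> s \<in> rb.G" if "s \<in> S" for s
    using rb.refl_basis_G[of "\<alpha> s"] rep_simple[OF that] that by (simp add: simple_roots_def)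
  have "\<rho> w \<in> rb.G" using w(1)
  proof (induction w rule: generate.induct)
    case one
    show ?case unfolding rep_one by (rule rb.id_G)
  next
    case (incl s)
    then show ?case by (rule simple)
  next
    case (inv s)
    then have "inv s = s" using generators_involutions generators_closed by (intro inv_equality) auto
    then show ?case using simple[OF inv] by simp
  next
    case (eng x y)
    then have c: "x \<in> carrier W" "y \<in> carrier W" using generators_generate by auto
    show ?case unfolding rep_mult[OF c] by (rule rb.comp_G[OF eng(3,4)])
  qed
  then show "g \<in> rb.G" using w(2) by simp
qed

lemma roots_eq: "roots = rb.roots"
  unfolding roots_def rb.roots_def G_eq by blast

lemma pos_roots_iff: "x \<in> pos_roots \<longleftrightarrow> x \<in> rb.roots \<and> x \<in> rb.C"
  by (auto simp: pos_roots_def roots_eq)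

lemma inversions_iff:
  assumes "w \<in> carrier W"
  shows "x \<in> inversions w \<longleftrightarrow> x \<in> pos_roots \<and> - \<rho> (inv w) x \<in> rb.C"
proof -
  have G: "\<rho> w \<in> rb.G" "\<rho> (inv w) \<in> rb.G" using assms by (auto simp: G_eq)
  have "x \<in> \<rho> w ` neg_roots \<longleftrightarrow> \<rho> (inv w) x \<in> neg_roots"
  proof
    assume "x \<in> \<rho> w ` neg_roots"
    then show "\<rho> (inv w) x \<in> neg_roots" using rep_inv(1)[OF assms] by auto
  next
    assume "\<rho> (inv w) x \<in> neg_roots"
    then show "x \<in> \<rho> w ` neg_roots"
      by (rule image_eqI[rotated]) (simp add: rep_inv(2)[OF assms])
  qed
  also have "\<dots> \<longleftrightarrow> - \<rho> (inv w) x \<in> pos_roots"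
    unfolding neg_roots_def by (auto intro: image_eqI[of _ _ "- \<rho> (inv w) x"])
  finally have "x \<in> \<rho> w ` neg_roots \<longleftrightarrow> - \<rho> (inv w) x \<in> pos_roots" .
  moreover have "- \<rho> (inv w) x \<in> rb.roots" if "x \<in> pos_roots"
    using that rb.neg_root[OF rb.G_roots[OF G(2)]] by (simp add: pos_roots_iff)
  ultimately show ?thesis by (auto simp: inversions_def pos_roots_iff)
qed

lemma dominates_iff:
  assumes "x \<in> pos_roots" "y \<in> pos_roots"
  shows "dominates x y \<longleftrightarrow> rb.dom x y"
proof
  assume dom: "dominates x y"
  show "rb.dom x y" unfolding rb.dom_def G_eq
  proof (intro ballI impI)
    fix g assume "g \<in> \<rho> ` carrier W" "- g x \<in> rb.C"
    then obtain w where w: "w \<in> carrier W" "g = \<rho> (inv (inv w))" by auto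
    then have "x \<in> inversions (inv w)" using assms(1) \<open>- g x \<in> rb.C\<close> by (simp add: inversions_iff)
    then have "y \<in> inversions (inv w)" using dom w(1) by (simp add: dominates_def)
    then show "- g y \<in> rb.C" using w by (simp add: inversions_iff)
  qed
next
  assume dom: "rb.dom x y"
  show "dominates x y" unfolding dominates_def
  proof (intro ballI impI)
    fix w assume w: "w \<in> carrier W" "x \<in> inversions w"
    have "\<rho> (inv w) \<in> rb.G" using w(1) by (auto simp: G_eq)
    then show "y \<in> inversions w" using w assms(2) rb.domD[OF dom] by (simp add: inversions_iff)
  qed
qed

lemma small_roots_iff: "x \<in> small_roots \<longleftrightarrow> x \<in> pos_roots \<and> \<not> rb.nonsmall x"
  unfolding small_roots_def rb.nonsmall_def using dominates_iff[of x] by (auto simp: pos_roots_iff)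

lemma root_reflection:
  assumes "x \<in> rb.roots"
  shows "root_reflection x \<in> carrier W" "\<rho> (root_reflection x) = form_reflection B x"
    "\<rho> (inv (root_reflection x)) = form_reflection B x"
proof -
  obtain r where r: "r \<in> carrier W" "\<rho> r = form_reflection B x"
    using rb.refl_root_G[OF assms] by (auto simp: G_eq)
  have "root_reflection x = r"
    unfolding root_reflection_def using r rep_faithful by (intro the_equality) (auto simp: inj_on_def)
  then show 1: "root_reflection x \<in> carrier W" "\<rho> (root_reflection x) = form_reflection B x" using r by simp_all
  show "\<rho> (inv (root_reflection x)) = form_reflection B x"
  proof
    fix v
    have "v = form_reflection B x (form_reflection B x v)"
      using rb.refl_refl rb.root_norm[OF assms] by simp
    then show "\<rho> (inv (root_reflection x)) v = form_reflection B x v"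
      using rep_inv(1)[OF 1(1), of "form_reflection B x v"] 1(2) by simp
  qed
qed

text \<open>
  Every element of the subgroup moves each vector by a vector of \<open>P\<close>, and the reflection in \<open>x\<close> moves
  \<open>x\<close> by \<open>- 2 x\<close>.
\<close>
lemma sub_roots_plane:
  assumes P: "subspace P" and H: "H = generate W (root_reflection ` (P \<inter> roots))"
  shows "sub_roots H = P \<inter> roots"
proof (rule equalityI; rule subsetI)
  fix x assume "x \<in> P \<inter> roots"
  then show "x \<in> sub_roots H" unfolding sub_roots_def H by (auto intro: generate.incl)
next
  fix x assume "x \<in> sub_roots H"
  then have x: "x \<in> rb.roots" "root_reflection x \<in> H" by (auto simp: sub_roots_def roots_eq)
  have gen: "h \<in> carrier W" "\<rho> h v - v \<in> P" if h: "h \<in> root_reflection ` (P \<inter> roots)" for h v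
  proof -
    obtain y where y: "y \<in> P" "y \<in> rb.roots" "h = root_reflection y" using h by (auto simp: roots_eq)
    show "h \<in> carrier W" using root_reflection(1)[OF y(2)] y(3) by simp
    have e: "\<rho> h v - v = (- 2 * B y v) *\<^sub>R y"
      unfolding y(3) root_reflection(2)[OF y(2)] by (simp add: form_reflection_def)
    show "\<rho> h v - v \<in> P" unfolding e by (rule subspace_scale[OF P y(1)])
  qed
  have "\<rho> h v - v \<in> P" if "h \<in> H" for h v
    using that unfolding H
  proof (induction h arbitrary: v rule: generate.induct)
    case one
    then show ?case using P by (simp add: rep_one subspace_0)
  next
    case (incl h)
    then show ?case by (rule gen(2))
  next
    case (inv h)
    have "\<rho> h (\<rho> (inv h) v) - \<rho> (inv h) v \<in> P" by (rule gen(2)[OF inv])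
    then have "v - \<rho> (inv h) v \<in> P" using rep_inv(2)[OF gen(1)[OF inv]] by simp
    from subspace_neg[OF P this] show ?case by simp
  next
    case (eng h k)
    have "generate W (root_reflection ` (P \<inter> roots)) \<subseteq> carrier W"
      using gen(1) by (intro generate_incl) blast
    then have c: "h \<in> carrier W" "k \<in> carrier W" using eng(1,2) by blast+
    have "(\<rho> h (\<rho> k v) - \<rho> k v) + (\<rho> k v - v) \<in> P" by (intro subspace_add[OF P] eng.IH)
    then show ?case by (simp add: rep_mult[OF c])
  qed
  from this[OF x(2), of x] have "form_reflection B x x - x \<in> P" unfolding root_reflection(2)[OF x(1)] .
  then have "(- 2) *\<^sub>R x \<in> P" using rb.refl_self[OF rb.root_norm[OF x(1)]] by (simp add: scaleR_2)
  from subspace_scale[OF P this, of "- 1 / 2"] show "x \<in> P \<inter> roots" using x(1) by (simp add: roots_eq)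
qed

lemma canonical_simple_iff:
  assumes P: "subspace P" and H: "H = generate W (root_reflection ` (P \<inter> roots))"
  shows "x \<in> canonical_simple H \<longleftrightarrow> x \<in> P \<and> x \<in> pos_roots \<and>
    (\<forall>y\<in>P. y \<in> pos_roots \<longrightarrow> y \<noteq> x \<longrightarrow> form_reflection B x y \<in> rb.C)"
proof (cases "x \<in> pos_roots")
  case True
  then have x: "x \<in> rb.roots" "x \<in> rb.C" by (auto simp: pos_roots_iff)
  have inv: "y \<in> inversions (root_reflection x) \<longleftrightarrow> y \<in> pos_roots \<and> form_reflection B x y \<notin> rb.C" for y
  proof -
    have "- form_reflection B x y \<in> rb.C \<longleftrightarrow> form_reflection B x y \<notin> rb.C" if "y \<in> rb.roots"
      using rb.root_sign[OF rb.refl_root[OF x(1) that]] rb.root_not_both[OF rb.refl_root[OF x(1) that]] by blast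
    then show ?thesis
      unfolding inversions_iff[OF root_reflection(1)[OF x(1)]] root_reflection(3)[OF x(1)]
      by (auto simp: pos_roots_iff)
  qed
  have self: "x \<in> inversions (root_reflection x)"
    unfolding inv using True rb.root_not_both[OF x] rb.refl_self[OF rb.root_norm[OF x(1)]] by simp
  have "x \<in> canonical_simple H \<longleftrightarrow> inversions (root_reflection x) \<inter> (P \<inter> roots) = {x}"
    unfolding canonical_simple_def sub_roots_plane[OF assms] using True by simp
  also have "\<dots> \<longleftrightarrow> x \<in> P \<and> (\<forall>y\<in>P. y \<in> inversions (root_reflection x) \<longrightarrow> y = x)"
    using self True by (auto simp: inversions_def pos_roots_def)
  also have "\<dots> \<longleftrightarrow> x \<in> P \<and> x \<in> pos_roots \<and>
    (\<forall>y\<in>P. y \<in> pos_roots \<longrightarrow> y \<noteq> x \<longrightarrow> form_reflection B x y \<in> rb.C)"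
    unfolding inv using True by blast
  finally show ?thesis .
qed (simp add: canonical_simple_def)

theorem small_roots_bipodal: "bipodal small_roots"
  unfolding bipodal_def
proof (intro conjI allI impI subsetI)
  fix x assume "x \<in> small_roots"
  then show "x \<in> pos_roots" by (simp add: small_roots_iff)
next
  fix H a
  assume "maximal_dihedral H" and "small_roots \<inter> (sub_pos_roots H - canonical_simple H) \<noteq> {}"
    and a: "a \<in> canonical_simple H"
  then obtain P g where P: "subspace P" "dim P = 2" and H: "H = generate W (root_reflection ` (P \<inter> roots))"
    and g: "g \<in> small_roots" "g \<in> sub_pos_roots H" "g \<notin> canonical_simple H"
    by (auto simp: maximal_dihedral_def)
  note canonical = canonical_simple_iff[OF P(1) H]
  have gP: "g \<in> P" "g \<in> pos_roots" using g(2) sub_roots_plane[OF P(1) H] by (auto simp: sub_pos_roots_def)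
  then obtain r where r: "r \<in> P" "r \<in> pos_roots" "r \<noteq> g" "form_reflection B g r \<notin> rb.C"
    using g(3) unfolding canonical by blast
  have a': "a \<in> P" "a \<in> pos_roots" "\<And>y. \<lbrakk>y \<in> P; y \<in> pos_roots; y \<noteq> a\<rbrakk> \<Longrightarrow> form_reflection B a y \<in> rb.C"
    using a unfolding canonical by blast+
  have "rb.nonsmall g" if "rb.nonsmall a"
  proof (rule rb.plane_nonsmall[OF P _ _ _ _ _ _ _ _ _ _ _ _ that])
    show "form_reflection B a x \<in> rb.C" if "x \<in> P" "x \<in> rb.roots" "x \<in> rb.C" "x \<noteq> a" for x
      using a'(3) that by (simp add: pos_roots_iff)
  qed (use a' gP r in \<open>auto simp: pos_roots_iff\<close>)
  then show "a \<in> small_roots" using a'(2) g(1) by (auto simp: small_roots_iff)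
qed

end

theorem theorem4p18:
  fixes W :: "('g, 'b) monoid_scheme"
    and S :: "'g set"
    and B :: "'v::real_vector \<Rightarrow> 'v \<Rightarrow> real"
    and \<alpha> :: "'g \<Rightarrow> 'v"
    and \<rho> :: "'g \<Rightarrow> 'v \<Rightarrow> 'v"
  assumes "geometric_representation W S B \<alpha> \<rho>"
  shows "geometric_representation.bipodal W S B \<alpha> \<rho>
           (geometric_representation.small_roots W S \<alpha> \<rho>)"
  by (rule geometric_representation.small_roots_bipodal[OF assms])

end
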